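(* Let $\mu_n$ ($n\in\mathbb{N}$) and $\mu$ be finite signed Borel measures on $\mathbb{R}$, and let $F^{(\mu_n)}$ and $F^{(\mu)}$ be their distribution functions. Then $\mu_n$ converges vaguely to $\mu$ if and only if $(\mu_n)_{n\in\mathbb{N}}$ is locally uniformly bounded in variation and there exists a sequence $(c_n)_{n\in\mathbb{N}}$ in $\mathbb{R}$ such that $F^{(\mu_n)}+c_n$ converges to $F^{(\mu)}$ locally in Lebesgue measure.
   Context: For a finite signed Borel measure $\mu$ on $\mathbb{R}$, $|\mu|$ denotes its total variation measure and $F^{(\mu)}(x)=\mu((-\infty,x])$ its distribution function. $\mu_n$ converges vaguely to $\mu$ if $\int f\,d\mu_n\to\int f\,d\mu$ for all continuous $f:\mathbb{R}\to\mathbb{R}$ with compact support. $(\mu_n)$ is locally uniformly bounded in variation if $\sup_{n}|\mu_n|([-r,r])<\infty$ for all $r\in\mathbb{R}$. Functions $g_n$ converge to $g$ locally in Lebesgue measure if for all $\varepsilon>0$ and $r>0$, $\lim_{n\to\infty}\lambda(\{x\in[-r,r]:|g_n(x)-g(x)|>\varepsilon\})=0$, where $\lambda$ is Lebesgue measure. *)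

theory Defs
  imports "HOL-Analysis.Analysis"
begin

section \<open>Finite signed measures\<close>

text \<open>
  A finite signed measure on the measurable space \<open>M\<close> is a real-valued, countably additive set
  function on \<open>sets M\<close>; its values outside \<open>sets M\<close> are irrelevant. Only the
  \<open>\<sigma>\<close>-algebra of \<open>M\<close> is used. Convergence of the series does not depend on
  the enumeration of the sets, so it is automatically absolute.
\<close>

definition finite_signed_measure :: "'a measure \<Rightarrow> ('a set \<Rightarrow> real) \<Rightarrow> bool" where
  "finite_signed_measure M \<mu> \<longleftrightarrow>
     \<mu> {} = 0 \<and>
     (\<forall>A :: nat \<Rightarrow> 'a set. range A \<subseteq> sets M \<longrightarrow> disjoint_family A \<longrightarrow>
        (\<lambda>i. \<mu> (A i)) sums \<mu> (\<Union>i. A i))"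

text \<open>
  Jordan decomposition \<open>\<mu> = \<mu>\<^sup>+ - \<mu>\<^sup>-\<close>, with
  \<open>\<mu>\<^sup>+ E = sup {\<mu> A | A \<subseteq> E measurable}\<close> and
  \<open>\<mu>\<^sup>- = (-\<mu>)\<^sup>+\<close>. The function \<open>ennreal\<close> truncates negative
  values to 0, which does not change the supremum because of \<open>A = {}\<close>. The lemmas below
  show that these are finite measures with difference \<open>\<mu>\<close>.
\<close>

definition upper_variation :: "'a measure \<Rightarrow> ('a set \<Rightarrow> real) \<Rightarrow> 'a measure" where
  "upper_variation M \<mu> =
     measure_of (space M) (sets M) (\<lambda>E. SUP A\<in>{A \<in> sets M. A \<subseteq> E}. ennreal (\<mu> A))"

definition lower_variation :: "'a measure \<Rightarrow> ('a set \<Rightarrow> real) \<Rightarrow> 'a measure" where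
  "lower_variation M \<mu> = upper_variation M (\<lambda>A. - \<mu> A)"

definition total_variation :: "'a measure \<Rightarrow> ('a set \<Rightarrow> real) \<Rightarrow> 'a measure" where
  "total_variation M \<mu> =
     measure_of (space M) (sets M)
       (\<lambda>E. emeasure (upper_variation M \<mu>) E + emeasure (lower_variation M \<mu>) E)"

definition signed_integral :: "'a measure \<Rightarrow> ('a set \<Rightarrow> real) \<Rightarrow> ('a \<Rightarrow> real) \<Rightarrow> real" where
  "signed_integral M \<mu> f =
     (\<integral>x. f x \<partial>upper_variation M \<mu>) - (\<integral>x. f x \<partial>lower_variation M \<mu>)"

lemma finite_signed_measure_uminus:
  "finite_signed_measure M \<mu> \<Longrightarrow> finite_signed_measure M (\<lambda>A. - \<mu> A)"
  by (auto simp: finite_signed_measure_def intro: sums_minus)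

lemma finite_signed_measure_sums:
  assumes "finite_signed_measure M \<mu>" "range A \<subseteq> sets M" "disjoint_family A"
  shows "(\<lambda>i. \<mu> (A i)) sums \<mu> (\<Union>i. A i)"
  using assms by (auto simp: finite_signed_measure_def)

lemma finite_signed_measure_Un:
  assumes \<mu>: "finite_signed_measure M \<mu>" and "A \<in> sets M" "B \<in> sets M" "A \<inter> B = {}"
  shows "\<mu> (A \<union> B) = \<mu> A + \<mu> B"
proof -
  have "(\<lambda>i. \<mu> (binaryset A B i)) sums \<mu> (\<Union>i. binaryset A B i)"
    using assms
    by (intro finite_signed_measure_sums[OF \<mu>])
       (auto simp: disjoint_family_on_def binaryset_def)
  moreover have "(\<lambda>i. \<mu> (binaryset A B i)) sums (\<mu> A + \<mu> B)"
    using \<mu> by (intro binaryset_sums) (auto simp: finite_signed_measure_def)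
  ultimately show ?thesis
    by (simp add: UN_binaryset_eq sums_unique2)
qed

lemma sets_upper_variation [simp, measurable_cong]: "sets (upper_variation M \<mu>) = sets M"
  and space_upper_variation [simp]: "space (upper_variation M \<mu>) = space M"
  by (simp_all add: upper_variation_def)

lemma sets_lower_variation [simp, measurable_cong]: "sets (lower_variation M \<mu>) = sets M"
  and space_lower_variation [simp]: "space (lower_variation M \<mu>) = space M"
  by (simp_all add: lower_variation_def)

lemma sets_total_variation [simp, measurable_cong]: "sets (total_variation M \<mu>) = sets M"
  and space_total_variation [simp]: "space (total_variation M \<mu>) = space M"
  by (simp_all add: total_variation_def)

lemma emeasure_upper_variation:
  assumes \<mu>: "finite_signed_measure M \<mu>" and E: "E \<in> sets M"
  shows "emeasure (upper_variation M \<mu>) E = (SUP A\<in>{A \<in> sets M. A \<subseteq> E}. ennreal (\<mu> A))"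
proof -
  define f where "f = (\<lambda>E. SUP A\<in>{A \<in> sets M. A \<subseteq> E}. ennreal (\<mu> A))"
  have \<mu>0: "\<mu> {} = 0"
    using \<mu> by (simp add: finite_signed_measure_def)
  have ub: "ennreal (\<mu> A) \<le> f E" if "A \<in> sets M" "A \<subseteq> E" for A E
    unfolding f_def using that by (intro SUP_upper) auto
  have f0: "f {} = 0"
  proof -
    have "{A \<in> sets M. A \<subseteq> {}} = {{}}" by auto
    then show ?thesis by (simp add: f_def \<mu>0)
  qed
  have mono: "f E \<le> f F" if "E \<subseteq> F" for E F
    unfolding f_def using that by (intro SUP_subset_mono) auto
  have sup2: "f E + f F \<le> f (E \<union> F)" if "E \<inter> F = {}" for E F
  proof -
    have *: "ennreal (\<mu> A) + ennreal (\<mu> B) \<le> f (E \<union> F)"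
      if "A \<in> sets M" "A \<subseteq> E" "B \<in> sets M" "B \<subseteq> F" for A B
    proof -
      have "\<mu> (A \<union> B) = \<mu> A + \<mu> B"
        using that \<open>E \<inter> F = {}\<close> by (intro finite_signed_measure_Un[OF \<mu>]) auto
      moreover have "ennreal (\<mu> (A \<union> B)) \<le> f (E \<union> F)"
        using that by (intro ub) auto
      moreover have "ennreal (\<mu> A) \<le> f (E \<union> F)" "ennreal (\<mu> B) \<le> f (E \<union> F)"
        using that by (auto intro!: ub)
      ultimately show ?thesis
        by (cases "\<mu> A \<ge> 0"; cases "\<mu> B \<ge> 0") (auto simp: ennreal_neg)
    qed
    have ne: "{A \<in> sets M. A \<subseteq> X} \<noteq> {}" for X
      by auto
    have "f E + f F = (SUP A\<in>{A \<in> sets M. A \<subseteq> E}. ennreal (\<mu> A) + f F)"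
      unfolding f_def by (intro ennreal_SUP_add_left[symmetric] ne)
    also have "\<dots> = (SUP A\<in>{A \<in> sets M. A \<subseteq> E}. SUP B\<in>{A \<in> sets M. A \<subseteq> F}. ennreal (\<mu> A) + ennreal (\<mu> B))"
      unfolding f_def by (intro SUP_cong refl ennreal_SUP_add_right ne)
    also have "\<dots> \<le> f (E \<union> F)"
      by (intro SUP_least) (auto intro: *)
    finally show ?thesis .
  qed
  have "countably_additive (sets M) f"
  proof (rule countably_additiveI)
    fix A :: "nat \<Rightarrow> 'a set"
    assume A: "range A \<subseteq> sets M" "disjoint_family A"
    show "(\<Sum>i. f (A i)) = f (\<Union>i. A i)"
    proof (rule antisym)
      have part: "(\<Sum>i<n. f (A i)) \<le> f (\<Union>i<n. A i)" for n
      proof (induction n)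
        case (Suc n)
        have "(\<Sum>i<Suc n. f (A i)) \<le> f (\<Union>i<n. A i) + f (A n)"
          using Suc by (simp add: add_right_mono)
        also have "\<dots> \<le> f ((\<Union>i<n. A i) \<union> A n)"
        proof (rule sup2)
          have "A i \<inter> A n = {}" if "i < n" for i
            using A(2) that by (intro disjoint_family_onD[of A UNIV]) auto
          then show "(\<Union>i<n. A i) \<inter> A n = {}" by blast
        qed
        also have "(\<Union>i<n. A i) \<union> A n = (\<Union>i<Suc n. A i)"
          by (auto simp: lessThan_Suc)
        finally show ?case .
      qed (simp add: f0)
      show "(\<Sum>i. f (A i)) \<le> f (\<Union>i. A i)"
        unfolding suminf_eq_SUP
        by (intro SUP_least order_trans[OF part] mono) auto
      show "f (\<Union>i. A i) \<le> (\<Sum>i. f (A i))"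
      proof (unfold f_def[THEN fun_cong, of "\<Union>i. A i"], rule SUP_least)
        fix B assume "B \<in> {B \<in> sets M. B \<subseteq> (\<Union>i. A i)}"
        then have B: "B \<in> sets M" "B = (\<Union>i. B \<inter> A i)" by auto
        have "(\<lambda>i. \<mu> (B \<inter> A i)) sums \<mu> (\<Union>i. B \<inter> A i)"
          using A B(1) by (intro finite_signed_measure_sums[OF \<mu>]) 
            (auto simp: disjoint_family_on_def)
        then have "(\<lambda>n. \<Sum>i<n. \<mu> (B \<inter> A i)) \<longlonglongrightarrow> \<mu> B"
          using B(2) by (simp add: sums_def)
        then have "(\<lambda>n. ennreal (\<Sum>i<n. \<mu> (B \<inter> A i))) \<longlonglongrightarrow> ennreal (\<mu> B)"
          by (rule tendsto_ennrealI)
        moreover have "ennreal (\<Sum>i<n. \<mu> (B \<inter> A i)) \<le> (\<Sum>i. f (A i))" for n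
        proof -
          have "ennreal (\<Sum>i<n. \<mu> (B \<inter> A i)) \<le> ennreal (\<Sum>i<n. max 0 (\<mu> (B \<inter> A i)))"
            by (intro ennreal_leI sum_mono) auto
          also have "\<dots> = (\<Sum>i<n. ennreal (\<mu> (B \<inter> A i)))"
            using sum_ennreal[of "{..<n}" "\<lambda>i. max 0 (\<mu> (B \<inter> A i))"]
            by (simp add: ennreal_max_0)
          also have "\<dots> \<le> (\<Sum>i<n. f (A i))"
            using A(1) B(1) by (intro sum_mono ub) auto
          also have "\<dots> \<le> (\<Sum>i. f (A i))"
            by (intro sum_le_suminf) auto
          finally show ?thesis .
        qed
        ultimately show "ennreal (\<mu> B) \<le> (\<Sum>i. f (A i))"
          by (intro LIMSEQ_le_const2) auto
      qed
    qed
  qed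
  then have "emeasure (measure_of (space M) (sets M) f) E = f E"
    using E f0
    by (intro emeasure_measure_of_sigma)
       (auto simp: positive_def sets.sigma_algebra_axioms)
  then show ?thesis
    by (simp add: upper_variation_def f_def)
qed

lemma upper_variation_upper:
  assumes "finite_signed_measure M \<mu>" "E \<in> sets M" "A \<in> sets M" "A \<subseteq> E"
  shows "ennreal (\<mu> A) \<le> emeasure (upper_variation M \<mu>) E"
  using assms by (auto simp: emeasure_upper_variation intro!: SUP_upper)

lemma finite_measure_upper_variation:
  assumes \<mu>: "finite_signed_measure M \<mu>"
  shows "finite_measure (upper_variation M \<mu>)"
proof (rule ccontr)
  define U where "U = upper_variation M \<mu>"
  have sets_U: "sets U = sets M" and space_U: "space U = space M"
    by (simp_all add: U_def)
  assume "\<not> finite_measure (upper_variation M \<mu>)"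
  then have top: "emeasure U (space M) = \<infinity>"
    by (metis U_def finite_measureI infinity_ennreal_def space_upper_variation)
  let ?P = "\<lambda>E. E \<in> sets M \<and> emeasure U E = \<infinity>"
  have step: "\<exists>F. ?P F \<and> F \<subseteq> E \<and> 1 \<le> \<bar>\<mu> (E - F)\<bar>" if E: "?P E" for E
  proof -
    have "ennreal (1 + \<bar>\<mu> E\<bar>) < (SUP A\<in>{A \<in> sets M. A \<subseteq> E}. ennreal (\<mu> A))"
      using E emeasure_upper_variation[OF \<mu>, of E] by (simp add: U_def)
    then obtain A where A: "A \<in> sets M" "A \<subseteq> E" "ennreal (1 + \<bar>\<mu> E\<bar>) < ennreal (\<mu> A)"
      by (auto simp only: less_SUP_iff)
    from A(3) have 1: "1 + \<bar>\<mu> E\<bar> < \<mu> A"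
      by (subst (asm) ennreal_less_iff) auto
    have EA: "E = A \<union> (E - A)" using A by auto
    have "\<mu> (A \<union> (E - A)) = \<mu> A + \<mu> (E - A)"
      using E A by (intro finite_signed_measure_Un[OF \<mu>]) auto
    then have 2: "\<mu> E = \<mu> A + \<mu> (E - A)"
      using EA by simp
    have "emeasure U E = emeasure U A + emeasure U (E - A)"
      using E A plus_emeasure[of A U "E - A"] EA by (auto simp: sets_U)
    then have "emeasure U A = \<infinity> \<or> emeasure U (E - A) = \<infinity>"
      using E by (metis ennreal_add_eq_top infinity_ennreal_def)
    then show ?thesis
    proof
      assume "emeasure U A = \<infinity>"
      then show ?thesis using A 1 2 by (intro exI[of _ A]) auto
    next
      assume *: "emeasure U (E - A) = \<infinity>"
      have "E - (E - A) = A" using A by auto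
      then show ?thesis using A E 1 * by (intro exI[of _ "E - A"]) auto
    qed
  qed
  have "\<exists>E. \<forall>n. ?P (E n) \<and> (E (Suc n) \<subseteq> E n \<and> 1 \<le> \<bar>\<mu> (E n - E (Suc n))\<bar>)"
  proof (rule dependent_nat_choice)
    show "\<exists>E. ?P E" using top by blast
  next
    fix E and n :: nat assume "?P E"
    then show "\<exists>F. ?P F \<and> (F \<subseteq> E \<and> 1 \<le> \<bar>\<mu> (E - F)\<bar>)"
      using step[of E] by blast
  qed
  then obtain E where E: "\<And>n. E n \<in> sets M" "\<And>n. E (Suc n) \<subseteq> E n"
      "\<And>n::nat. 1 \<le> \<bar>\<mu> (E n - E (Suc n))\<bar>"
    by blast
  have dec: "E m \<subseteq> E n" if "n \<le> m" for m n
    using lift_Suc_antimono_le[of E, OF E(2) that] .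
  have "disjoint_family (\<lambda>n. E n - E (Suc n))"
    unfolding disjoint_family_on_def
  proof (intro ballI impI)
    fix m n :: nat assume "m \<noteq> n"
    then show "(E m - E (Suc m)) \<inter> (E n - E (Suc n)) = {}"
      using dec[of "Suc m" n] dec[of "Suc n" m] by (cases "m < n") auto
  qed
  then have "(\<lambda>n. \<mu> (E n - E (Suc n))) sums \<mu> (\<Union>n. E n - E (Suc n))"
    using E(1) by (intro finite_signed_measure_sums[OF \<mu>]) auto
  then have "(\<lambda>n. \<mu> (E n - E (Suc n))) \<longlonglongrightarrow> 0"
    by (intro summable_LIMSEQ_zero) (rule sums_summable)
  then have "(\<lambda>n. \<bar>\<mu> (E n - E (Suc n))\<bar>) \<longlonglongrightarrow> 0"
    by (rule tendsto_rabs_zero)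
  then have "1 \<le> (0::real)"
    using E(3) by (intro LIMSEQ_le_const) auto
  then show False by simp
qed

lemma finite_measure_lower_variation:
  "finite_signed_measure M \<mu> \<Longrightarrow> finite_measure (lower_variation M \<mu>)"
  unfolding lower_variation_def
  by (intro finite_measure_upper_variation finite_signed_measure_uminus)

lemma Jordan_decomposition:
  assumes \<mu>: "finite_signed_measure M \<mu>" and E: "E \<in> sets M"
  shows "\<mu> E = measure (upper_variation M \<mu>) E - measure (lower_variation M \<mu>) E"
proof -
  have le: "measure (upper_variation M \<nu>) E \<le> \<nu> E + measure (upper_variation M (\<lambda>A. - \<nu> A)) E"
    if \<nu>: "finite_signed_measure M \<nu>" for \<nu>
  proof -
    note \<nu>' = finite_signed_measure_uminus[OF \<nu>]
    interpret U: finite_measure "upper_variation M \<nu>"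
      by (rule finite_measure_upper_variation[OF \<nu>])
    interpret L: finite_measure "upper_variation M (\<lambda>A. - \<nu> A)"
      by (rule finite_measure_upper_variation[OF \<nu>'])
    let ?c = "\<nu> E + measure (upper_variation M (\<lambda>A. - \<nu> A)) E"
    have lower: "- \<nu> A \<le> measure (upper_variation M (\<lambda>A. - \<nu> A)) E"
      if "A \<in> sets M" "A \<subseteq> E" for A
      using upper_variation_upper[OF \<nu>' E that] L.emeasure_eq_measure
      by (simp add: ennreal_le_iff)
    have "emeasure (upper_variation M \<nu>) E \<le> ennreal ?c"
      unfolding emeasure_upper_variation[OF \<nu> E]
    proof (rule SUP_least)
      fix A assume "A \<in> {A \<in> sets M. A \<subseteq> E}"
      then have A: "A \<in> sets M" "A \<subseteq> E" by auto
      have "\<nu> (A \<union> (E - A)) = \<nu> A + \<nu> (E - A)"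
        using E A by (intro finite_signed_measure_Un[OF \<nu>]) auto
      moreover have "A \<union> (E - A) = E" using A by auto
      ultimately have "\<nu> A \<le> ?c"
        using lower[of "E - A"] A E by auto
      then show "ennreal (\<nu> A) \<le> ennreal ?c"
        by (rule ennreal_leI)
    qed
    moreover have "0 \<le> ?c"
      using lower[of E] E by simp
    ultimately show ?thesis
      by (simp add: U.emeasure_eq_measure ennreal_le_iff)
  qed
  show ?thesis
    using le[OF \<mu>] le[OF finite_signed_measure_uminus[OF \<mu>]]
    by (simp add: lower_variation_def)
qed

lemma emeasure_total_variation:
  assumes E: "E \<in> sets M"
  shows "emeasure (total_variation M \<mu>) E =
    emeasure (upper_variation M \<mu>) E + emeasure (lower_variation M \<mu>) E"
proof -
  have "countably_additive (sets M)
    (\<lambda>E. emeasure (upper_variation M \<mu>) E + emeasure (lower_variation M \<mu>) E)"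
    by (auto intro!: countably_additiveI simp: suminf_add[symmetric] suminf_emeasure)
  then show ?thesis
    using E unfolding total_variation_def
    by (intro emeasure_measure_of_sigma)
       (auto simp: positive_def sets.sigma_algebra_axioms)
qed


section \<open>Signed Borel measures on the real line\<close>

definition signed_cdf :: "(real set \<Rightarrow> real) \<Rightarrow> real \<Rightarrow> real" where
  "signed_cdf \<mu> x = \<mu> {..x}"

definition vaguely_converges ::
    "(nat \<Rightarrow> real set \<Rightarrow> real) \<Rightarrow> (real set \<Rightarrow> real) \<Rightarrow> bool" where
  "vaguely_converges \<mu>s \<mu> \<longleftrightarrow>
     (\<forall>f :: real \<Rightarrow> real. continuous_on UNIV f \<longrightarrow> compact (closure {x. f x \<noteq> 0}) \<longrightarrow>
        (\<lambda>n. signed_integral borel (\<mu>s n) f) \<longlonglongrightarrow> signed_integral borel \<mu> f)"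

definition locally_uniformly_bounded_variation :: "(nat \<Rightarrow> real set \<Rightarrow> real) \<Rightarrow> bool" where
  "locally_uniformly_bounded_variation \<mu>s \<longleftrightarrow>
     (\<forall>r :: real. (SUP n. emeasure (total_variation borel (\<mu>s n)) {-r..r}) < \<infinity>)"

text \<open>
  Only meant for Lebesgue measurable functions, such as distribution functions, since
  \<open>emeasure\<close> is 0 on non-measurable sets.
\<close>

definition converges_locally_in_lebesgue_measure ::
    "(nat \<Rightarrow> real \<Rightarrow> real) \<Rightarrow> (real \<Rightarrow> real) \<Rightarrow> bool" where
  "converges_locally_in_lebesgue_measure gs g \<longleftrightarrow>
     (\<forall>\<epsilon>>0. \<forall>r>0.
        (\<lambda>n. emeasure lebesgue {x \<in> {-r..r}. \<bar>gs n x - g x\<bar> > \<epsilon>}) \<longlonglongrightarrow> 0)"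

end

theory Submission
  imports Defs
begin

text \<open>
  If \<open>\<mu>\<^sub>n\<close> converges vaguely, the functionals \<open>g \<mapsto> \<integral> \<phi> g d\<mu>\<^sub>n\<close> on the bounded continuous
  functions, with a compactly supported cutoff \<open>\<phi>\<close>, are pointwise bounded, so the uniform
  boundedness principle bounds the variation on compact sets. Let \<open>\<rho>\<^sub>h\<^sub>,\<^sub>x\<close> be the continuous function
  that is 1 on \<open>{..x}\<close>, 0 on \<open>{x + h..}\<close> and affine in between. The difference
  \<open>\<rho>\<^sub>h\<^sub>,\<^sub>x - \<rho>\<^sub>1\<^sub>,\<^sub>0\<close> has compact support, and \<open>\<rho>\<^sub>h\<^sub>,\<^sub>x\<close> differs from the indicator of \<open>{..x}\<close> only on the
  window \<open>{x<..x + h}\<close>. Hence with \<open>c\<^sub>n = \<integral> \<rho>\<^sub>1\<^sub>,\<^sub>0 d(\<mu> - \<mu>\<^sub>n)\<close> the function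
  \<open>F\<^sub>n + c\<^sub>n - F\<close> is a pointwise null sequence up to an error \<open>(\<bar>\<mu>\<^sub>n\<bar> + \<bar>\<mu>\<bar>) {x<..x + h}\<close>, whose
  integral over \<open>x\<close> in a compact interval is \<open>O(h)\<close> uniformly in \<open>n\<close>.

  Conversely, replace a test function \<open>f\<close> by its averages over \<open>{x..<x + h}\<close>, which are uniformly
  close to \<open>f\<close>. By Fubini, their integral against \<open>\<mu>\<^sub>n\<close> is
  \<open>(1/h) \<integral> f(t) (F\<^sub>n(t) - F\<^sub>n(t - h)) dt\<close>. Here the constants \<open>c\<^sub>n\<close> cancel and the increments are
  locally bounded by the variation, so convergence in measure suffices to pass to the limit.
\<close>

section \<open>Integration against signed measures\<close>

lemma finite_measure_total_variation:
  assumes "finite_signed_measure M \<mu>"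
  shows "finite_measure (total_variation M \<mu>)"
proof -
  interpret P: finite_measure "upper_variation M \<mu>"
    using assms by (rule finite_measure_upper_variation)
  interpret N: finite_measure "lower_variation M \<mu>"
    using assms by (rule finite_measure_lower_variation)
  show ?thesis
    by (rule finite_measureI) (simp add: emeasure_total_variation)
qed

lemma measure_total_variation:
  assumes "finite_signed_measure M \<mu>" and "E \<in> sets M"
  shows "measure (total_variation M \<mu>) E =
    measure (upper_variation M \<mu>) E + measure (lower_variation M \<mu>) E"
proof -
  interpret P: finite_measure "upper_variation M \<mu>"
    using assms(1) by (rule finite_measure_upper_variation)
  interpret N: finite_measure "lower_variation M \<mu>"
    using assms(1) by (rule finite_measure_lower_variation)
  interpret T: finite_measure "total_variation M \<mu>"
    using assms(1) by (rule finite_measure_total_variation)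
  show ?thesis
    using emeasure_total_variation[OF assms(2), of \<mu>]
    by (simp add: P.emeasure_eq_measure N.emeasure_eq_measure T.emeasure_eq_measure
        flip: ennreal_plus)
qed

lemma abs_integral_le_measure:
  fixes f :: "'a \<Rightarrow> real"
  assumes "finite_measure M" and "S \<in> sets M"
    and bound: "\<And>x. x \<in> space M \<Longrightarrow> \<bar>f x\<bar> \<le> B * indicator S x"
  shows "\<bar>\<integral>x. f x \<partial>M\<bar> \<le> B * measure M S"
proof (cases "integrable M f")
  case True
  interpret finite_measure M by fact
  have int: "integrable M (\<lambda>x. B * indicator S x :: real)"
    using assms(2) by (intro integrable_mult_right integrable_real_indicator) (auto simp: emeasure_eq_measure)
  have "\<bar>\<integral>x. f x \<partial>M\<bar> \<le> (\<integral>x. \<bar>f x\<bar> \<partial>M)"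
    by (rule integral_abs_bound)
  also have "\<dots> \<le> (\<integral>x. B * indicator S x \<partial>M)"
    using True int bound by (intro integral_mono) auto
  also have "\<dots> = B * measure M S"
    using sets.sets_into_space[OF assms(2)] by (simp add: Int_absorb2)
  finally show ?thesis .
next
  case False
  \<comment> \<open>The Bochner integral of a non-integrable function is 0, so it remains to see
    that the right-hand side is nonnegative; a negative \<open>B\<close> forces \<open>S\<close> to
    be empty.\<close>
  have "0 \<le> B \<or> S = {}"
  proof (rule disjCI)
    assume "S \<noteq> {}"
    then obtain x where "x \<in> S" by auto
    with bound[of x] sets.sets_into_space[OF assms(2)] show "0 \<le> B" by auto
  qed
  with False show ?thesis by (auto simp: not_integrable_integral_eq)
qed

text \<open>Each Jordan part contributes at most \<open>B\<close> times its own mass of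
  \<open>S\<close>, and the two masses add up to the total variation. This is how errors supported
  in \<open>S\<close> are measured below.\<close>

lemma abs_signed_integral_le:
  assumes \<mu>: "finite_signed_measure M \<mu>" and S: "S \<in> sets M"
    and bound: "\<And>x. x \<in> space M \<Longrightarrow> \<bar>f x\<bar> \<le> B * indicator S x"
  shows "\<bar>signed_integral M \<mu> f\<bar> \<le> B * measure (total_variation M \<mu>) S"
proof -
  have "\<bar>\<integral>x. f x \<partial>upper_variation M \<mu>\<bar> \<le> B * measure (upper_variation M \<mu>) S"
    using S bound by (intro abs_integral_le_measure finite_measure_upper_variation[OF \<mu>]) auto
  moreover have "\<bar>\<integral>x. f x \<partial>lower_variation M \<mu>\<bar> \<le> B * measure (lower_variation M \<mu>) S"
    using S bound by (intro abs_integral_le_measure finite_measure_lower_variation[OF \<mu>]) auto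
  ultimately show ?thesis
    by (simp add: signed_integral_def measure_total_variation[OF \<mu> S] algebra_simps)
qed

lemma integrable_variation:
  fixes f :: "'a \<Rightarrow> real"
  assumes \<mu>: "finite_signed_measure M \<mu>"
    and f: "f \<in> borel_measurable M" and b: "\<And>x. x \<in> space M \<Longrightarrow> \<bar>f x\<bar> \<le> B"
  shows "integrable (upper_variation M \<mu>) f" "integrable (lower_variation M \<mu>) f"
proof -
  interpret P: finite_measure "upper_variation M \<mu>"
    using \<mu> by (rule finite_measure_upper_variation)
  interpret N: finite_measure "lower_variation M \<mu>"
    using \<mu> by (rule finite_measure_lower_variation)
  show "integrable (upper_variation M \<mu>) f"
    using f b by (intro P.integrable_const_bound[where B = B]) (auto cong: measurable_cong_sets)
  show "integrable (lower_variation M \<mu>) f"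
    using f b by (intro N.integrable_const_bound[where B = B]) (auto cong: measurable_cong_sets)
qed

lemma signed_integral_add:
  assumes \<mu>: "finite_signed_measure M \<mu>"
    and f: "f \<in> borel_measurable M" "\<And>x. x \<in> space M \<Longrightarrow> \<bar>f x\<bar> \<le> B"
    and g: "g \<in> borel_measurable M" "\<And>x. x \<in> space M \<Longrightarrow> \<bar>g x\<bar> \<le> C"
  shows "signed_integral M \<mu> (\<lambda>x. f x + g x) = signed_integral M \<mu> f + signed_integral M \<mu> g"
  using integrable_variation[OF \<mu> f] integrable_variation[OF \<mu> g]
  by (simp add: signed_integral_def)

lemma signed_integral_diff:
  assumes \<mu>: "finite_signed_measure M \<mu>"
    and f: "f \<in> borel_measurable M" "\<And>x. x \<in> space M \<Longrightarrow> \<bar>f x\<bar> \<le> B"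
    and g: "g \<in> borel_measurable M" "\<And>x. x \<in> space M \<Longrightarrow> \<bar>g x\<bar> \<le> C"
  shows "signed_integral M \<mu> (\<lambda>x. f x - g x) = signed_integral M \<mu> f - signed_integral M \<mu> g"
  using integrable_variation[OF \<mu> f] integrable_variation[OF \<mu> g]
  by (simp add: signed_integral_def)

lemma signed_integral_cmult:
  "signed_integral M \<mu> (\<lambda>x. c * f x) = c * signed_integral M \<mu> f"
  by (simp add: signed_integral_def right_diff_distrib)

lemma signed_integral_indicator:
  assumes "finite_signed_measure M \<mu>" "E \<in> sets M"
  shows "signed_integral M \<mu> (indicator E) = \<mu> E"
  using assms sets.sets_into_space[OF assms(2)]
  by (simp add: signed_integral_def Jordan_decomposition Int_absorb2)

section \<open>Local boundedness of the variation\<close>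

text \<open>Banach-Steinhaus via Baire: pointwise boundedness makes the closed sets
  \<open>V k\<close> cover the Banach space, so some \<open>V k\<close> contains a ball, and
  linearity turns the bound on that ball into a bound on the operator norms.\<close>

lemma uniform_boundedness:
  fixes L :: "'i \<Rightarrow> 'a::{real_normed_vector, complete_space} \<Rightarrow> 'b::real_normed_vector"
  assumes L: "\<And>i. bounded_linear (L i)" and pt: "\<And>x. bounded (range (\<lambda>i. L i x))"
  obtains C where "\<And>i x. norm (L i x) \<le> C * norm x"
proof -
  define V where "V k = {x. \<forall>i. norm (L i x) \<le> real k}" for k :: nat
  have "closed (V k)" for k
  proof -
    have "V k = (\<Inter>i. {x. norm (L i x) \<le> real k})" by (auto simp: V_def)
    moreover have "closed {x. norm (L i x) \<le> real k}" for i
      by (intro closed_Collect_le continuous_intros bounded_linear.continuous_on[OF L])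
    ultimately show ?thesis by auto
  qed
  moreover have "(\<Union>k. V k) = UNIV"
  proof -
    have "\<exists>k. x \<in> V k" for x
    proof -
      obtain B where B: "\<And>i. norm (L i x) \<le> B"
        using pt[of x] by (auto simp: bounded_iff)
      obtain k :: nat where "B \<le> real k" using real_arch_simple by blast
      with B have "norm (L i x) \<le> real k" for i by (meson order_trans)
      then show ?thesis by (auto simp: V_def)
    qed
    then show ?thesis by auto
  qed
  ultimately have "\<exists>k. interior (V k) \<noteq> {}"
    using Met_TC.metric_Baire_category_alt[of "range V"] complete_UNIV
    by (auto simp del: UN_extend_simps)
  then obtain k x0 where "x0 \<in> interior (V k)" by auto
  then obtain \<rho> where \<rho>: "0 < \<rho>" "cball x0 \<rho> \<subseteq> V k"
    by (auto simp: mem_interior_cball)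
  have "norm (L i x) \<le> (2 * real k / \<rho>) * norm x" for i x
  proof (cases "x = 0")
    case True
    then show ?thesis by (simp add: bounded_linear.linear[OF L] linear_0)
  next
    case False
    interpret bounded_linear "L i" by (rule L)
    \<comment> \<open>The vector \<open>x\<close> is rescaled to norm \<open>\<rho>\<close>, so that
      \<open>x0\<close> and \<open>x0 + y\<close> both lie in the ball; recovering \<open>y\<close>
      as their difference costs the factor 2.\<close>
    define y where "y = (\<rho> / norm x) *\<^sub>R x"
    have "x0 + y \<in> cball x0 \<rho>" "x0 \<in> cball x0 \<rho>"
      using \<rho>(1) False by (auto simp: y_def dist_norm)
    then have "x0 + y \<in> V k" "x0 \<in> V k"
      using \<rho>(2) by blast+
    then have "norm (L i (x0 + y)) \<le> k" "norm (L i x0) \<le> k"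
      by (auto simp: V_def)
    moreover have "L i y = L i (x0 + y) - L i x0"
      by (simp add: add)
    ultimately have "norm (L i y) \<le> 2 * k"
      using norm_triangle_ineq4[of "L i (x0 + y)" "L i x0"] by simp
    moreover have "norm (L i y) = \<rho> / norm x * norm (L i x)"
      using \<rho>(1) by (simp add: y_def scaleR)
    ultimately show ?thesis
      using \<rho>(1) False by (simp add: field_simps)
  qed
  then show thesis by (rule that)
qed

text \<open>Regularity puts \<open>A\<close> between a compact \<open>K\<close> and an open
  \<open>U\<close> with \<open>U - K\<close> small, and Urysohn's lemma gives a continuous function
  that is 1 on \<open>K\<close> and 0 off \<open>U\<close>. The error is recorded as a pointwise
  bound by the indicator of \<open>D = U - K\<close>, a form that can be integrated against a signed
  measure.\<close>

lemma indicator_approx_continuous: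
  fixes M :: "'a::euclidean_space measure"
  assumes M: "finite_measure M" "sets M = sets borel" and A: "A \<in> sets borel" and "0 < \<epsilon>"
  obtains g :: "'a \<Rightarrow> real" and D where "continuous_on UNIV g" "\<And>x. 0 \<le> g x" "\<And>x. g x \<le> 1"
    "D \<in> sets borel" "measure M D < \<epsilon>" "\<And>x. \<bar>g x - indicator A x\<bar> \<le> indicator D x"
proof -
  interpret finite_measure M by fact
  have fin: "emeasure M (space M) \<noteq> \<infinity>" by simp
  \<comment> \<open>Inner regularity is a statement in \<open>ennreal\<close>, where a negative
    \<open>measure M A - \<epsilon> / 2\<close> would be truncated to 0. In that case the empty set
    serves as \<open>K\<close>.\<close>
  have "\<exists>K. K \<subseteq> A \<and> compact K \<and> measure M A < measure M K + \<epsilon> / 2"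
  proof (cases "measure M A < \<epsilon> / 2")
    case True
    then show ?thesis by (intro exI[of _ "{}"]) auto
  next
    case False
    then have "ennreal (measure M A - \<epsilon> / 2) < emeasure M A"
      using \<open>0 < \<epsilon>\<close> by (simp add: emeasure_eq_measure ennreal_less_iff)
    then obtain K where "K \<subseteq> A" "compact K" "ennreal (measure M A - \<epsilon> / 2) < emeasure M K"
      unfolding inner_regular[OF M(2) fin A] less_SUP_iff by auto
    with False show ?thesis
      by (intro exI[of _ K]) (auto simp: emeasure_eq_measure ennreal_less_iff)
  qed
  then obtain K where K: "K \<subseteq> A" "compact K" "measure M A < measure M K + \<epsilon> / 2" by auto
  have "emeasure M A < ennreal (measure M A + \<epsilon> / 2)"
    using \<open>0 < \<epsilon>\<close> by (simp add: emeasure_eq_measure ennreal_lessI)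
  then obtain U where "A \<subseteq> U" "open U" "emeasure M U < ennreal (measure M A + \<epsilon> / 2)"
    unfolding outer_regular[OF M(2) fin A] INF_less_iff by auto
  then have U: "A \<subseteq> U" "open U" "measure M U < measure M A + \<epsilon> / 2"
    by (auto simp: emeasure_eq_measure ennreal_less_iff)
  obtain g :: "'a \<Rightarrow> real" where g: "continuous_on UNIV g" "\<And>x. g x \<in> closed_segment 1 0"
    "\<And>x. x \<in> K \<Longrightarrow> g x = 1" "\<And>x. x \<in> - U \<Longrightarrow> g x = 0"
    using Urysohn[of K "- U" 1 0] K U by (auto simp: compact_imp_closed)
  have g01: "0 \<le> g x" "g x \<le> 1" for x
    using g(2)[of x] by (auto simp: closed_segment_eq_real_ivl)
  have "measure M (U - K) = measure M U - measure M K"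
    using K U by (intro finite_measure_Diff) (auto simp: M compact_imp_closed)
  then have "measure M (U - K) < \<epsilon>" using K U by simp
  moreover have "\<bar>g x - indicator A x\<bar> \<le> indicator (U - K) x" for x
    using g01[of x] g(3,4)[of x] K(1) U(1) by (auto simp: indicator_def)
  ultimately show thesis
    using g(1) g01 K U by (intro that[of g "U - K"]) (auto simp: compact_imp_closed)
qed

section \<open>Measurability of distribution functions and convergence in measure\<close>

lemma borel_measurable_signed_cdf [measurable]:
  assumes \<mu>: "finite_signed_measure borel \<mu>"
  shows "signed_cdf \<mu> \<in> borel_measurable borel"
proof -
  interpret P: finite_measure "upper_variation borel \<mu>"
    using \<mu> by (rule finite_measure_upper_variation)
  interpret N: finite_measure "lower_variation borel \<mu>"
    using \<mu> by (rule finite_measure_lower_variation)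
  have "mono (\<lambda>x. measure (upper_variation borel \<mu>) {..x})"
    by (intro monoI P.finite_measure_mono) auto
  moreover have "mono (\<lambda>x. measure (lower_variation borel \<mu>) {..x})"
    by (intro monoI N.finite_measure_mono) auto
  moreover have "signed_cdf \<mu> = (\<lambda>x. measure (upper_variation borel \<mu>) {..x} -
      measure (lower_variation borel \<mu>) {..x})"
    by (simp add: fun_eq_iff signed_cdf_def Jordan_decomposition[OF \<mu>])
  ultimately show ?thesis
    by (simp only: borel_measurable_diff borel_measurable_mono)
qed

text \<open>The exceptional sets are Borel, so \<open>lebesgue\<close> and \<open>lborel\<close>
  agree on them, and they lie in a bounded interval, so their measures are finite and can be handled
  as real numbers.\<close>

lemma converges_locally_in_lebesgue_measure_iff:
  assumes gs: "\<And>n. gs n \<in> borel_measurable borel" and g: "g \<in> borel_measurable borel"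
  shows "converges_locally_in_lebesgue_measure gs g \<longleftrightarrow>
    (\<forall>\<epsilon>>0. \<forall>r>0. (\<lambda>n. measure lborel {x \<in> {-r..r}. \<bar>gs n x - g x\<bar> > \<epsilon>}) \<longlonglongrightarrow> 0)"
proof -
  have "emeasure lebesgue {x \<in> {-r..r}. \<bar>gs n x - g x\<bar> > \<epsilon>} =
      ennreal (measure lborel {x \<in> {-r..r}. \<bar>gs n x - g x\<bar> > \<epsilon>})" for r \<epsilon> :: real and n
  proof -
    note [measurable] = gs[of n] g
    have *: "{x \<in> {-r..r}. \<bar>gs n x - g x\<bar> > \<epsilon>} \<in> sets borel" by measurable
    have "emeasure lborel {x \<in> {-r..r}. \<bar>gs n x - g x\<bar> > \<epsilon>} \<le> emeasure lborel {-r..r}"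
      by (intro emeasure_mono) auto
    also have "\<dots> < \<infinity>" by (simp add: emeasure_lborel_Icc_eq)
    finally show ?thesis
      using * by (simp add: emeasure_eq_ennreal_measure less_top)
  qed
  then show ?thesis
    by (simp add: converges_locally_in_lebesgue_measure_def ennreal_tendsto_0_iff)
qed

text \<open>Dominated convergence for the indicators of the exceptional sets: at every point they
  vanish for large \<open>n\<close>, and the indicator of \<open>S\<close> is an integrable
  majorant.\<close>

lemma tendsto_measure_of_tendsto:
  fixes f :: "nat \<Rightarrow> 'a \<Rightarrow> real"
  assumes [measurable]: "\<And>n. f n \<in> borel_measurable M" and S: "S \<in> sets M" "emeasure M S < \<infinity>"
    and lim: "\<And>x. x \<in> S \<Longrightarrow> (\<lambda>n. f n x) \<longlonglongrightarrow> 0" and "0 < \<epsilon>"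
  shows "(\<lambda>n. measure M {x \<in> S. \<epsilon> < \<bar>f n x\<bar>}) \<longlonglongrightarrow> 0"
proof -
  define A where "A n = {x \<in> S. \<epsilon> < \<bar>f n x\<bar>}" for n
  have [measurable]: "A n \<in> sets M" for n
  proof -
    have "A n = {x \<in> space M. \<epsilon> < \<bar>f n x\<bar>} \<inter> S"
      using sets.sets_into_space[OF S(1)] by (auto simp: A_def)
    then show ?thesis using S(1) by simp
  qed
  have "(\<lambda>n. \<integral>x. indicator (A n) x \<partial>M) \<longlonglongrightarrow> (\<integral>x. 0 \<partial>M :: real)"
  proof (rule integral_dominated_convergence[where w = "indicator S"])
    show "integrable M (indicator S :: 'a \<Rightarrow> real)"
      using S by simp
    show "AE x in M. (\<lambda>n. indicator (A n) x :: real) \<longlonglongrightarrow> 0"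
    proof (rule AE_I2)
      fix x assume "x \<in> space M"
      show "(\<lambda>n. indicator (A n) x :: real) \<longlonglongrightarrow> 0"
      proof (cases "x \<in> S")
        case True
        have "\<forall>\<^sub>F n in sequentially. \<bar>f n x\<bar> < \<epsilon>"
          using order_tendstoD(2)[OF tendsto_rabs_zero[OF lim[OF True]] \<open>0 < \<epsilon>\<close>] .
        then have "\<forall>\<^sub>F n in sequentially. indicator (A n) x = (0::real)"
          by eventually_elim (auto simp: A_def)
        then show ?thesis by (rule tendsto_eventually)
      qed (simp add: A_def)
    qed
  qed (simp_all, auto simp: A_def indicator_def)
  moreover have "A n \<inter> space M = A n" for n
    using sets.sets_into_space[OF S(1)] by (auto simp: A_def)
  ultimately show ?thesis by (simp add: A_def)
qed

section \<open>Compactly supported test functions and the variation on compact sets\<close>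

lemma compact_closure_support:
  fixes f :: "real \<Rightarrow> real"
  assumes "\<And>x. x \<notin> {a..b} \<Longrightarrow> f x = 0"
  shows "compact (closure {x. f x \<noteq> 0})"
proof -
  have "{x. f x \<noteq> 0} \<subseteq> {a..b}" using assms by blast
  from bounded_subset[OF bounded_closed_interval this] show ?thesis by simp
qed

lemma vaguely_converges_tendsto:
  fixes f :: "real \<Rightarrow> real"
  assumes "vaguely_converges \<mu>s \<mu>" "continuous_on UNIV f" "\<And>x. x \<notin> {a..b} \<Longrightarrow> f x = 0"
  shows "(\<lambda>n. signed_integral borel (\<mu>s n) f) \<longlonglongrightarrow> signed_integral borel \<mu> f"
  using assms(1,2) compact_closure_support[of a b f, OF assms(3)] unfolding vaguely_converges_def by blast

lemma vaguely_converges_imp_locally_bounded: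
  assumes \<mu>s: "\<And>n. finite_signed_measure borel (\<mu>s n)" and vague: "vaguely_converges \<mu>s \<mu>"
  shows "locally_uniformly_bounded_variation \<mu>s"
  unfolding locally_uniformly_bounded_variation_def
proof
  fix r :: real
  \<comment> \<open>The cutoff makes every product \<open>\<phi> x * g x\<close> a test function, so
    \<open>L n\<close> can be studied on the whole space of bounded continuous functions, which is
    complete, as the uniform boundedness principle requires.\<close>
  define \<phi> :: "real \<Rightarrow> real" where "\<phi> x = max 0 (min 1 (r + 1 - \<bar>x\<bar>))" for x
  have \<phi>: "continuous_on UNIV \<phi>" "\<And>x. 0 \<le> \<phi> x" "\<And>x. \<phi> x \<le> 1" "\<And>x. x \<in> {-r..r} \<Longrightarrow> \<phi> x = 1"
    "\<And>x. x \<notin> {-(r + 1)..r + 1} \<Longrightarrow> \<phi> x = 0"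
    by (auto simp: \<phi>_def intro!: continuous_intros)
  define L where "L n g = signed_integral borel (\<mu>s n) (\<lambda>x. \<phi> x * apply_bcontfun g x)"
    for n and g :: "real \<Rightarrow>\<^sub>C real"
  have meas [measurable]: "\<phi> \<in> borel_measurable borel"
    "apply_bcontfun g \<in> borel_measurable borel" for g :: "real \<Rightarrow>\<^sub>C real"
    using \<phi>(1) by (auto intro!: borel_measurable_continuous_onI)
  have bnd: "\<bar>\<phi> x * apply_bcontfun g x\<bar> \<le> norm g" for x g
  proof -
    have "\<bar>\<phi> x\<bar> * \<bar>apply_bcontfun g x\<bar> \<le> 1 * norm g"
      using \<phi>(2,3)[of x] norm_bounded[of g x] by (intro mult_mono) auto
    then show ?thesis by (simp add: abs_mult)
  qed
  have "bounded_linear (L n)" for n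
  proof (rule bounded_linear_intro)
    show "L n (g + h) = L n g + L n h" for g h
      using signed_integral_add[OF \<mu>s[of n] _ bnd[of _ g] _ bnd[of _ h]]
      by (simp add: L_def distrib_left)
    show "L n (c *\<^sub>R g) = c *\<^sub>R L n g" for c g
      by (simp add: L_def signed_integral_cmult mult.left_commute)
    show "norm (L n g) \<le> norm g * measure (total_variation borel (\<mu>s n)) UNIV" for g
      using bnd[of _ g] unfolding L_def real_norm_def
      by (intro abs_signed_integral_le[OF \<mu>s[of n]]) auto
  qed
  moreover have "bounded (range (\<lambda>n. L n g))" for g
    unfolding L_def
    by (rule convergent_imp_bounded, rule vaguely_converges_tendsto[OF vague, of _ "-(r + 1)" "r + 1"])
      (use \<phi> in \<open>auto intro!: continuous_intros\<close>)
  ultimately obtain C where C: "\<And>n g. norm (L n g) \<le> C * norm g"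
    using uniform_boundedness[of L] by blast
  \<comment> \<open>The bound on \<open>L n\<close> is tested on a continuous \<open>g\<close> with
    values between 0 and 1 that equals the indicator of \<open>A\<close> off a set \<open>D\<close>
    of variation less than \<open>e\<close>. Since \<open>\<phi>\<close> is 1 on \<open>A\<close>
    and between 0 and 1 elsewhere, the product with \<open>\<phi>\<close> keeps this
    approximation.\<close>
  have le: "\<bar>\<mu>s n A\<bar> \<le> \<bar>C\<bar>" if A: "A \<in> sets borel" "A \<subseteq> {-r..r}" for n A
  proof (rule field_le_epsilon)
    fix e :: real assume "0 < e"
    obtain g :: "real \<Rightarrow> real" and D where g: "continuous_on UNIV g" "\<And>x. 0 \<le> g x" "\<And>x. g x \<le> 1"
      and D: "D \<in> sets borel" "measure (total_variation borel (\<mu>s n)) D < e"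
        "\<And>x. \<bar>g x - indicator A x\<bar> \<le> indicator D x"
      using indicator_approx_continuous[OF finite_measure_total_variation[OF \<mu>s[of n]]
          sets_total_variation A(1) \<open>0 < e\<close>]
      by blast
    have "g \<in> bcontfun"
      using g by (intro bcontfun_normI[where b = 1]) auto
    then have G: "apply_bcontfun (Bcontfun g) = g" by (rule Bcontfun_inverse)
    have "norm (Bcontfun g) \<le> 1"
      using g by (intro norm_bound) (auto simp: G)
    then have "\<bar>L n (Bcontfun g)\<bar> \<le> \<bar>C\<bar>"
      using C[of n "Bcontfun g"] mult_mono[of C "\<bar>C\<bar>" "norm (Bcontfun g)" 1]
        abs_ge_self[of C] by (simp del: abs_ge_self)
    moreover have "L n (Bcontfun g) - \<mu>s n A =
        signed_integral borel (\<mu>s n) (\<lambda>x. \<phi> x * g x - indicator A x)"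
      using bnd[of _ "Bcontfun g"] A(1) meas(2)[of "Bcontfun g"]
      by (subst signed_integral_diff[OF \<mu>s[of n], of _ "norm (Bcontfun g)" _ 1])
        (auto simp: L_def G signed_integral_indicator[OF \<mu>s[of n]])
    moreover have "\<bar>\<phi> x * g x - indicator A x\<bar> \<le> 1 * indicator D x" for x
    proof (cases "x \<in> A")
      case True
      then show ?thesis using D(3)[of x] \<phi>(4)[of x] A(2) by auto
    next
      case False
      then show ?thesis
        using D(3)[of x] \<phi>(2,3)[of x] g(2)[of x] mult_right_mono[of "\<phi> x" 1 "g x"] by auto
    qed
    then have "\<bar>signed_integral borel (\<mu>s n) (\<lambda>x. \<phi> x * g x - indicator A x)\<bar> \<le>
        1 * measure (total_variation borel (\<mu>s n)) D"
      using D(1) by (intro abs_signed_integral_le[OF \<mu>s[of n]]) auto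
    ultimately show "\<bar>\<mu>s n A\<bar> \<le> \<bar>C\<bar> + e"
      using D(2) by linarith
  qed
  \<comment> \<open>The upper variation is the supremum of the values on measurable subsets, so the
    bound on \<open>\<bar>\<mu>s n A\<bar>\<close> controls both Jordan parts, the lower one through
    the negated measure.\<close>
  have "emeasure (upper_variation borel \<nu>) {-r..r} \<le> ennreal \<bar>C\<bar>"
    if "finite_signed_measure borel \<nu>" "\<And>A. A \<in> sets borel \<Longrightarrow> A \<subseteq> {-r..r} \<Longrightarrow> \<nu> A \<le> \<bar>C\<bar>" for \<nu>
    using that by (auto simp: emeasure_upper_variation intro!: SUP_least ennreal_leI)
  note this[OF \<mu>s] this[OF finite_signed_measure_uminus[OF \<mu>s], folded lower_variation_def]
  then have "emeasure (total_variation borel (\<mu>s n)) {-r..r} \<le> ennreal \<bar>C\<bar> + ennreal \<bar>C\<bar>" for n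
    using le[of _ n] by (auto simp: emeasure_total_variation abs_le_iff intro!: add_mono)
  then have "(SUP n. emeasure (total_variation borel (\<mu>s n)) {-r..r}) \<le> ennreal \<bar>C\<bar> + ennreal \<bar>C\<bar>"
    by (rule SUP_least)
  also have "\<dots> < \<infinity>" by simp
  finally show "(SUP n. emeasure (total_variation borel (\<mu>s n)) {-r..r}) < \<infinity>" .
qed

section \<open>Convergence of the distribution functions\<close>

text \<open>By Tonelli, the mass of the sliding window \<open>{x<..x + h}\<close> integrates over \<open>x\<close>
  to at most \<open>h\<close> times the total mass; Markov's inequality does the rest.\<close>

lemma measure_window_le:
  fixes T :: "real measure"
  assumes T: "finite_measure T" "sets T = sets borel" and h: "0 \<le> h" and \<epsilon>: "0 < \<epsilon>"
  shows "measure lborel {x \<in> {a..b}. \<epsilon> < measure T {x<..x + h}} \<le> h * measure T {a..b + h} / \<epsilon>"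
proof -
  interpret T: finite_measure T by fact
  interpret pair_sigma_finite T "lborel :: real measure" ..
  note [measurable_cong] = T(2)
  define k :: "real \<Rightarrow> real \<Rightarrow> ennreal"
    where "k y x = (if x < y \<and> y \<le> x + h \<and> a \<le> x \<and> x \<le> b then 1 else 0)" for x y
  have [measurable]: "case_prod k \<in> borel_measurable (T \<Otimes>\<^sub>M lborel)"
    "(\<lambda>(x, y). k y x) \<in> borel_measurable (lborel \<Otimes>\<^sub>M T)"
    unfolding k_def by measurable
  define u where "u x = (\<integral>\<^sup>+y. k y x \<partial>T)" for x
  have [measurable]: "u \<in> borel_measurable lborel"
    unfolding u_def by measurable
  have u: "u x = ennreal (measure T {x<..x + h})" if "x \<in> {a..b}" for x
  proof -
    have "u x = (\<integral>\<^sup>+y. indicator {x<..x + h} y \<partial>T)"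
      unfolding u_def using that by (intro nn_integral_cong) (auto simp: k_def indicator_def)
    then show ?thesis by (simp add: T T.emeasure_eq_measure)
  qed
  have "(\<integral>\<^sup>+x. u x * indicator {a..b} x \<partial>lborel) \<le> (\<integral>\<^sup>+x. u x \<partial>lborel)"
    by (intro nn_integral_mono) (auto simp: indicator_def)
  also have "\<dots> = (\<integral>\<^sup>+y. (\<integral>\<^sup>+x. k y x \<partial>lborel) \<partial>T)"
    unfolding u_def by (rule Fubini') measurable
  \<comment> \<open>For fixed \<open>y\<close>, the points \<open>x\<close> with
    \<open>x < y \<le> x + h\<close> lie in an interval of length \<open>h\<close>, and
    \<open>a \<le> x \<le> b\<close> forces \<open>y\<close> into \<open>{a..b + h}\<close>.\<close>
  also have "\<dots> \<le> (\<integral>\<^sup>+y. (\<integral>\<^sup>+x. indicator {a..b + h} y * indicator {y - h..y} x \<partial>lborel) \<partial>T)"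
    using h by (intro nn_integral_mono) (auto simp: k_def indicator_def)
  also have "\<dots> = (\<integral>\<^sup>+y. indicator {a..b + h} y * ennreal h \<partial>T)"
    using h by (subst nn_integral_cmult) auto
  also have "\<dots> = ennreal (h * measure T {a..b + h})"
    using h by (subst nn_integral_multc)
      (auto simp: T T.emeasure_eq_measure ennreal_mult mult.commute)
  finally have int: "(\<integral>\<^sup>+x. u x * indicator {a..b} x \<partial>lborel) \<le> ennreal (h * measure T {a..b + h})" .
  have "emeasure lborel {x \<in> {a..b}. \<epsilon> < measure T {x<..x + h}} \<le>
      emeasure lborel {x \<in> {a..b}. 1 \<le> ennreal (1 / \<epsilon>) * u x}"
  proof (rule emeasure_mono)
    show "{x \<in> {a..b}. \<epsilon> < measure T {x<..x + h}} \<subseteq> {x \<in> {a..b}. 1 \<le> ennreal (1 / \<epsilon>) * u x}"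
      using \<epsilon> by (auto simp: u ennreal_mult[symmetric] ennreal_le_iff simp flip: ennreal_1)
    have "{x \<in> space lborel. x \<in> {a..b} \<and> 1 \<le> ennreal (1 / \<epsilon>) * u x} \<in> sets lborel"
      by measurable
    then show "{x \<in> {a..b}. 1 \<le> ennreal (1 / \<epsilon>) * u x} \<in> sets lborel" by simp
  qed
  also have "\<dots> \<le> ennreal (1 / \<epsilon>) * (\<integral>\<^sup>+x. u x * indicator {a..b} x \<partial>lborel)"
    by (rule nn_integral_Markov_inequality) auto
  also have "\<dots> \<le> ennreal (1 / \<epsilon>) * ennreal (h * measure T {a..b + h})"
    by (intro mult_left_mono int) auto
  also have "\<dots> = ennreal (h * measure T {a..b + h} / \<epsilon>)"
    using h \<epsilon> by (simp add: ennreal_mult[symmetric])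
  finally show ?thesis
    using h \<epsilon> by (simp add: measure_def enn2real_leI)
qed

section \<open>Uniform real bounds and continuous cutoffs of half-lines\<close>

lemma locally_uniformly_bounded_variationE:
  assumes \<mu>s: "\<And>n. finite_signed_measure borel (\<mu>s n)"
    and bv: "locally_uniformly_bounded_variation \<mu>s"
  obtains K where "0 \<le> K" "\<And>n. measure (total_variation borel (\<mu>s n)) {-r..r} \<le> K"
proof -
  define s where "s = (SUP n. emeasure (total_variation borel (\<mu>s n)) {-r..r})"
  have fin: "s < \<infinity>"
    using bv by (auto simp: locally_uniformly_bounded_variation_def s_def)
  have "measure (total_variation borel (\<mu>s n)) {-r..r} \<le> enn2real s" for n
    unfolding measure_def using fin by (intro enn2real_mono) (auto simp: s_def intro: SUP_upper)
  then show thesis by (intro that[of "enn2real s"]) auto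
qed

text \<open>This is \<open>\<rho>\<^sub>h\<^sub>,\<^sub>x\<close> from the outline; the clamped
  formula avoids a case distinction, which keeps continuity and joint measurability
  immediate.\<close>

definition ramp :: "real \<Rightarrow> real \<Rightarrow> real \<Rightarrow> real" where
  "ramp h x y = max 0 (min 1 ((x + h - y) / h))"

lemma ramp_range: "0 \<le> ramp h x y" "ramp h x y \<le> 1"
  by (auto simp: ramp_def)

lemma ramp_eq_1: "0 < h \<Longrightarrow> y \<le> x \<Longrightarrow> ramp h x y = 1"
  and ramp_eq_0: "0 < h \<Longrightarrow> x + h \<le> y \<Longrightarrow> ramp h x y = 0"
  by (auto simp: ramp_def field_simps)

lemma continuous_on_ramp: "0 < h \<Longrightarrow> continuous_on UNIV (ramp h x)"
  unfolding ramp_def by (intro continuous_intros) auto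

lemma abs_ramp_diff_indicator_le:
  "0 < h \<Longrightarrow> \<bar>ramp h x y - indicator {..x} y\<bar> \<le> indicator {x<..x + h} y"
  using ramp_range[of h x y] ramp_eq_1[of h y x] ramp_eq_0[of h x y]
  by (cases "y \<le> x"; cases "x + h \<le> y") (auto simp: indicator_def)

lemma borel_measurable_ramp [measurable]: "ramp h x \<in> borel_measurable borel"
  "(\<lambda>(x, y). ramp h x y) \<in> borel_measurable (borel \<Otimes>\<^sub>M borel)"
  unfolding ramp_def by measurable

lemma borel_measurable_signed_integral_ramp:
  assumes \<mu>: "finite_signed_measure borel \<mu>"
  shows "(\<lambda>x. signed_integral borel \<mu> (ramp h x)) \<in> borel_measurable borel"
proof -
  interpret P: finite_measure "upper_variation borel \<mu>"
    using \<mu> by (rule finite_measure_upper_variation)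
  interpret N: finite_measure "lower_variation borel \<mu>"
    using \<mu> by (rule finite_measure_lower_variation)
  show ?thesis
    unfolding signed_integral_def by measurable
qed

lemma vaguely_converges_imp_cdf_converges:
  assumes \<mu>s: "\<And>n. finite_signed_measure borel (\<mu>s n)" and \<mu>: "finite_signed_measure borel \<mu>"
    and vague: "vaguely_converges \<mu>s \<mu>"
  shows "\<exists>c. converges_locally_in_lebesgue_measure (\<lambda>n x. signed_cdf (\<mu>s n) x + c n) (signed_cdf \<mu>)"
proof
  note [measurable] = borel_measurable_signed_cdf[OF \<mu>s] borel_measurable_signed_cdf[OF \<mu>]
    borel_measurable_signed_integral_ramp[OF \<mu>s] borel_measurable_signed_integral_ramp[OF \<mu>]
  define J where "J n f = signed_integral borel (\<mu>s n) f - signed_integral borel \<mu> f" for n f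
  \<comment> \<open>For \<open>0 < h\<close>, this is the integral of the compactly supported
    function \<open>ramp h x - ramp 1 0\<close> against the difference of \<open>\<mu>s n\<close>
    and \<open>\<mu>\<close>. Subtracting the fixed ramp is what produces the constant in the
    conclusion.\<close>
  define A where "A h n x = J n (ramp h x) - J n (ramp 1 0)" for h n x
  define W where "W \<nu> h x = measure (total_variation borel \<nu>) {x<..x + h}"
    for \<nu> and h x :: real
  have ramp_bnd: "\<bar>ramp h x y\<bar> \<le> 1" for h x y
    using ramp_range[of h x y] by simp
  have near: "\<bar>signed_integral borel \<nu> (ramp h x) - signed_cdf \<nu> x\<bar> \<le> W \<nu> h x"
    if \<nu>: "finite_signed_measure borel \<nu>" and h: "0 < h" for \<nu> h x
  proof -
    have "signed_integral borel \<nu> (ramp h x) - signed_cdf \<nu> x =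
        signed_integral borel \<nu> (\<lambda>y. ramp h x y - indicator {..x} y)"
      using ramp_bnd by (subst signed_integral_diff[OF \<nu>, of _ 1 _ 1])
        (auto simp: signed_integral_indicator[OF \<nu>] signed_cdf_def)
    then show ?thesis
      using abs_signed_integral_le[OF \<nu>, of "{x<..x + h}" "\<lambda>y. ramp h x y - indicator {..x} y" 1]
        abs_ramp_diff_indicator_le[OF h] by (simp add: W_def)
  qed
  have lim: "(\<lambda>n. A h n x) \<longlonglongrightarrow> 0" if h: "0 < h" for h x
  proof -
    define f where "f y = ramp h x y - ramp 1 0 y" for y
    have "(\<lambda>n. signed_integral borel (\<mu>s n) f) \<longlonglongrightarrow> signed_integral borel \<mu> f"
    proof (rule vaguely_converges_tendsto[OF vague])
      show "continuous_on UNIV f"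
        unfolding f_def using h by (intro continuous_intros continuous_on_ramp) auto
      \<comment> \<open>To the left of both slopes the two values 1 cancel, and to the right both
        ramps are 0.\<close>
      show "f y = 0" if "y \<notin> {min x 0..max (x + h) 1}" for y
      proof (cases "y < min x 0")
        case True
        then show ?thesis using h by (simp add: f_def ramp_eq_1)
      next
        case False
        with that have "max (x + h) 1 < y" by auto
        then show ?thesis using h by (simp add: f_def ramp_eq_0)
      qed
    qed
    then have "(\<lambda>n. J n f) \<longlonglongrightarrow> 0"
      unfolding J_def by (rule LIM_zero)
    moreover have "signed_integral borel \<nu> f =
        signed_integral borel \<nu> (ramp h x) - signed_integral borel \<nu> (ramp 1 0)"
      if "finite_signed_measure borel \<nu>" for \<nu>
      unfolding f_def using ramp_bnd by (intro signed_integral_diff[OF that, of _ 1 _ 1]) auto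
    ultimately show ?thesis
      by (simp add: A_def J_def \<mu>s \<mu> algebra_simps)
  qed
  show "converges_locally_in_lebesgue_measure
    (\<lambda>n x. signed_cdf (\<mu>s n) x + - J n (ramp 1 0)) (signed_cdf \<mu>)"
  proof (subst converges_locally_in_lebesgue_measure_iff, goal_cases)
    case 3
    show ?case
    proof (intro allI impI)
      fix \<epsilon> r :: real assume \<epsilon>: "0 < \<epsilon>" and r: "0 < r"
      obtain K where K: "0 \<le> K"
        "\<And>n. measure (total_variation borel (\<mu>s n)) {-(r + 1)..r + 1} \<le> K"
        using locally_uniformly_bounded_variationE[OF \<mu>s
          vaguely_converges_imp_locally_bounded[OF \<mu>s vague], of "r + 1"] by auto
      define K' where "K' = measure (total_variation borel \<mu>) {-(r + 1)..r + 1}"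
      define bad where "bad n = {x \<in> {-r..r}.
        \<bar>signed_cdf (\<mu>s n) x + - J n (ramp 1 0) - signed_cdf \<mu> x\<bar> > \<epsilon>}" for n
      \<comment> \<open>Windows that start in \<open>{-r..r}\<close> with \<open>h \<le> 1\<close>
        stay in \<open>{-(r + 1)..r + 1}\<close>, where the variation of \<open>\<mu>s n\<close> is
        bounded uniformly in \<open>n\<close>.\<close>
      have win: "measure lborel {x \<in> {-r..r}. \<epsilon> / 4 < W \<nu> h x} \<le>
          4 * h * measure (total_variation borel \<nu>) {-(r + 1)..r + 1} / \<epsilon>"
        if \<nu>: "finite_signed_measure borel \<nu>" and h: "0 < h" "h \<le> 1" for \<nu> h
      proof -
        interpret T: finite_measure "total_variation borel \<nu>"
          using \<nu> by (rule finite_measure_total_variation)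
        have "measure lborel {x \<in> {-r..r}. \<epsilon> / 4 < W \<nu> h x} \<le>
            h * measure (total_variation borel \<nu>) {-r..r + h} / (\<epsilon> / 4)"
          unfolding W_def using h \<epsilon> by (intro measure_window_le T.finite_measure_axioms) auto
        also have "\<dots> \<le> h * measure (total_variation borel \<nu>) {-(r + 1)..r + 1} / (\<epsilon> / 4)"
          using h \<epsilon> by (intro divide_right_mono mult_left_mono T.finite_measure_mono) auto
        finally show ?thesis by (simp add: mult_ac)
      qed
      \<comment> \<open>The tolerance is split into \<open>\<epsilon> / 2\<close> for
        \<open>A h n\<close> and \<open>\<epsilon> / 4\<close> for each of the window errors of
        \<open>\<mu>s n\<close> and \<open>\<mu>\<close>.\<close>
      have bound: "measure lborel (bad n) \<le>
          measure lborel {x \<in> {-r..r}. \<epsilon> / 2 < \<bar>A h n x\<bar>} + 4 * h * (K + K') / \<epsilon>"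
        if h: "0 < h" "h \<le> 1" for n h
      proof -
        let ?A = "{x \<in> {-r..r}. \<epsilon> / 2 < \<bar>A h n x\<bar>}"
        let ?W = "\<lambda>\<nu>. {x \<in> {-r..r}. \<epsilon> / 4 < W \<nu> h x}"
        have W_meas [measurable]: "W \<nu> h \<in> borel_measurable borel"
          if "finite_signed_measure borel \<nu>" for \<nu>
        proof -
          interpret T: finite_measure "total_variation borel \<nu>"
            using that by (rule finite_measure_total_variation)
          have "W \<nu> h = (\<lambda>x. measure (total_variation borel \<nu>) {..x + h} -
              measure (total_variation borel \<nu>) {..x})"
          proof
            fix x
            have "{x<..x + h} = {..x + h} - {..x}" by auto
            then show "W \<nu> h x = measure (total_variation borel \<nu>) {..x + h} -
                measure (total_variation borel \<nu>) {..x}"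
              using h by (simp add: W_def T.finite_measure_Diff)
          qed
          moreover have "mono (\<lambda>x. measure (total_variation borel \<nu>) {..x})"
            "mono (\<lambda>x. measure (total_variation borel \<nu>) {..x + h})"
            by (auto intro!: monoI T.finite_measure_mono)
          ultimately show ?thesis
            by (simp only: borel_measurable_diff borel_measurable_mono)
        qed
        note [measurable] = W_meas[OF \<mu>s] W_meas[OF \<mu>]
        have [measurable]: "A h n \<in> borel_measurable borel"
          unfolding A_def J_def by measurable
        have fm: "B \<in> fmeasurable lborel" if "B \<in> sets borel" "B \<subseteq> {-r..r}" for B
        proof (rule fmeasurableI2[OF _ that(2)])
          show "{-r..r} \<in> fmeasurable lborel"
            by (rule fmeasurableI) (simp_all add: emeasure_lborel_Icc_eq)
        qed (use that(1) in simp)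
        have mA: "?A \<in> sets borel" by measurable
        have mW: "?W (\<mu>s n) \<in> sets borel" "?W \<mu> \<in> sets borel" by measurable
        have "bad n \<subseteq> ?A \<union> (?W (\<mu>s n) \<union> ?W \<mu>)"
        proof
          fix x assume x: "x \<in> bad n"
          have "signed_cdf (\<mu>s n) x + - J n (ramp 1 0) - signed_cdf \<mu> x =
              A h n x - (signed_integral borel (\<mu>s n) (ramp h x) - signed_cdf (\<mu>s n) x) +
              (signed_integral borel \<mu> (ramp h x) - signed_cdf \<mu> x)"
            by (simp add: A_def J_def)
          then show "x \<in> ?A \<union> (?W (\<mu>s n) \<union> ?W \<mu>)"
            using x near[OF \<mu>s[of n] h(1), of x] near[OF \<mu> h(1), of x] by (auto simp: bad_def)
        qed
        then have "measure lborel (bad n) \<le> measure lborel (?A \<union> (?W (\<mu>s n) \<union> ?W \<mu>))"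
          using mA mW by (intro measure_mono_fmeasurable fm) (auto simp: bad_def)
        also have "\<dots> \<le> measure lborel ?A + measure lborel (?W (\<mu>s n) \<union> ?W \<mu>)"
          using mA mW by (intro measure_Un_le) auto
        also have "\<dots> \<le> measure lborel ?A + (measure lborel (?W (\<mu>s n)) + measure lborel (?W \<mu>))"
          using mW by (intro add_left_mono measure_Un_le) auto
        also have "\<dots> \<le> measure lborel ?A + (4 * h * K / \<epsilon> + 4 * h * K' / \<epsilon>)"
        proof (intro add_left_mono add_mono)
          have "4 * h * measure (total_variation borel (\<mu>s n)) {-(r + 1)..r + 1} / \<epsilon> \<le> 4 * h * K / \<epsilon>"
            using h \<epsilon> K by (intro divide_right_mono mult_left_mono) auto
          then show "measure lborel (?W (\<mu>s n)) \<le> 4 * h * K / \<epsilon>"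
            using win[OF \<mu>s[of n] h] by linarith
          show "measure lborel (?W \<mu>) \<le> 4 * h * K' / \<epsilon>"
            using win[OF \<mu> h] by (simp add: K'_def)
        qed
        finally show ?thesis by (simp add: add_divide_distrib distrib_left)
      qed
      show "(\<lambda>n. measure lborel (bad n)) \<longlonglongrightarrow> 0"
      proof (rule LIMSEQ_I)
        fix \<eta> :: real assume \<eta>: "0 < \<eta>"
        have K': "0 \<le> K'" by (simp add: K'_def)
        \<comment> \<open>The width \<open>h\<close> is fixed before \<open>n\<close>: it makes the
          window terms at most \<open>\<eta> / 2\<close> for all \<open>n\<close> at once, and only
          then is \<open>n\<close> taken large. The summand 1 keeps the divisor positive.\<close>
        define d where "d = K + K' + 1"
        have d: "0 < d" "K + K' \<le> d" using K(1) K' by (auto simp: d_def)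
        define h where "h = min 1 (\<eta> * \<epsilon> / (8 * d))"
        have h: "0 < h" "h \<le> 1" using \<eta> \<epsilon> d by (auto simp: h_def)
        have "4 * h * (K + K') / \<epsilon> \<le> 4 * (\<eta> * \<epsilon> / (8 * d)) * d / \<epsilon>"
          using \<epsilon> \<eta> d K(1) K' by (intro divide_right_mono mult_mono) (auto simp: h_def)
        also have "\<dots> = \<eta> / 2"
          using \<epsilon> d by (simp add: field_simps)
        finally have small: "4 * h * (K + K') / \<epsilon> \<le> \<eta> / 2" .
        have "(\<lambda>n. measure lborel {x \<in> {-r..r}. \<epsilon> / 2 < \<bar>A h n x\<bar>}) \<longlonglongrightarrow> 0"
        proof (rule tendsto_measure_of_tendsto)
          show "A h n \<in> borel_measurable lborel" for n
            unfolding A_def J_def by measurable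
        qed (use \<epsilon> lim[OF h(1)] in \<open>auto simp: emeasure_lborel_Icc_eq\<close>)
        from LIMSEQ_D[OF this half_gt_zero[OF \<eta>]] obtain N where
          N: "\<And>n. N \<le> n \<Longrightarrow> measure lborel {x \<in> {-r..r}. \<epsilon> / 2 < \<bar>A h n x\<bar>} < \<eta> / 2"
          by auto
        have "norm (measure lborel (bad n) - 0) < \<eta>" if "N \<le> n" for n
          using bound[OF h, of n] N[OF that] small by simp
        then show "\<exists>N. \<forall>n\<ge>N. norm (measure lborel (bad n) - 0) < \<eta>" by blast
      qed
    qed
  qed measurable
qed

section \<open>Vague convergence from distribution functions\<close>

text \<open>The window is closed on the left and open on the right because
  \<open>x \<le> t < x + h\<close> then means that \<open>x\<close> lies in
  \<open>{t - h<..t}\<close>, whose mass is exactly an increment of the distribution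
  function.\<close>

definition window_average :: "real \<Rightarrow> (real \<Rightarrow> real) \<Rightarrow> real \<Rightarrow> real" where
  "window_average h f x = (\<integral>t. f t * indicator {x..<x + h} t \<partial>lborel) / h"

lemma borel_measurable_window_average [measurable]:
  assumes [measurable]: "f \<in> borel_measurable borel"
  shows "window_average h f \<in> borel_measurable borel"
proof -
  \<comment> \<open>The moving interval is viewed as a measurable set of pairs; joint measurability
    of the integrand then gives measurability of the parametrised integral.\<close>
  have "{p \<in> space (borel \<Otimes>\<^sub>M lborel). fst p \<le> snd p \<and> snd p < fst p + h} \<in> sets (borel \<Otimes>\<^sub>M lborel)"
    by measurable
  then have [measurable]: "Measurable.pred (borel \<Otimes>\<^sub>M lborel) (\<lambda>(x, t). x \<le> t \<and> t < x + h)"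
    by (simp add: pred_def case_prod_beta)
  have "(\<lambda>(x, t). f t * (if x \<le> t \<and> t < x + h then 1 else 0)) \<in> borel_measurable (borel \<Otimes>\<^sub>M lborel)"
    by measurable
  also have "(\<lambda>(x, t). f t * (if x \<le> t \<and> t < x + h then 1 else 0)) =
      (\<lambda>(x, t). f t * indicator {x..<x + h} t)"
    by (auto simp: fun_eq_iff indicator_def)
  finally have [measurable]: "(\<lambda>(x, t). f t * indicator {x..<x + h} t) \<in> borel_measurable (borel \<Otimes>\<^sub>M lborel)" .
  show ?thesis
    unfolding window_average_def by measurable
qed

text \<open>On the window, \<open>f t\<close> splits into \<open>f t - f x\<close>, which is bounded
  by \<open>\<eta>\<close>, and the constant \<open>f x\<close>, which averages to itself.\<close>

lemma window_average_close:
  assumes [measurable]: "f \<in> borel_measurable borel" and h: "0 < h"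
    and close: "\<And>t. x \<le> t \<Longrightarrow> t < x + h \<Longrightarrow> \<bar>f t - f x\<bar> \<le> \<eta>"
  shows "\<bar>window_average h f x - f x\<bar> \<le> \<eta>"
proof -
  have \<eta>: "0 \<le> \<eta>" using close[of x] h by auto
  have int: "integrable lborel (\<lambda>t. (f t - f x) * indicator {x..<x + h} t)"
  proof (rule integrableI_bounded_set[where A = "{x..<x + h}" and B = \<eta>])
    show "emeasure lborel {x..<x + h} < \<infinity>" using h by simp
  qed (use close in auto)
  have const: "integrable lborel (\<lambda>t. f x * indicator {x..<x + h} t)"
    using h by (intro integrable_mult_right integrable_real_indicator) auto
  have "(\<integral>t. f t * indicator {x..<x + h} t \<partial>lborel) =
      (\<integral>t. (f t - f x) * indicator {x..<x + h} t + f x * indicator {x..<x + h} t \<partial>lborel)"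
    by (simp add: algebra_simps)
  also have "\<dots> = (\<integral>t. (f t - f x) * indicator {x..<x + h} t \<partial>lborel) + f x * h"
    using int const h by (subst Bochner_Integration.integral_add) auto
  finally have "window_average h f x - f x = (\<integral>t. (f t - f x) * indicator {x..<x + h} t \<partial>lborel) / h"
    using h by (simp add: window_average_def field_simps)
  moreover have "\<bar>\<integral>t. (f t - f x) * indicator {x..<x + h} t \<partial>lborel\<bar> \<le> \<eta> * h"
  proof -
    have "\<bar>\<integral>t. (f t - f x) * indicator {x..<x + h} t \<partial>lborel\<bar> \<le>
        (\<integral>t. \<bar>(f t - f x) * indicator {x..<x + h} t\<bar> \<partial>lborel)"
      by (rule integral_abs_bound)
    also have "\<dots> \<le> (\<integral>t. \<eta> * indicator {x..<x + h} t \<partial>lborel)"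
      using int h close by (intro integral_mono integrable_abs integrable_mult_right integrable_real_indicator)
        (auto simp: indicator_def)
    also have "\<dots> = \<eta> * h" using h by simp
    finally show ?thesis .
  qed
  ultimately show ?thesis
    using h by (simp add: abs_divide divide_le_eq)
qed

lemma window_average_eq_0:
  assumes "\<And>t. x \<le> t \<Longrightarrow> t < x + h \<Longrightarrow> f t = 0"
  shows "window_average h f x = 0"
proof -
  have "(\<lambda>t. f t * indicator {x..<x + h} t) = (\<lambda>t. 0)"
    using assms by (auto simp: fun_eq_iff indicator_def)
  then show ?thesis by (simp add: window_average_def)
qed

text \<open>Fubini for the kernel \<open>k\<close>: integrating over \<open>t\<close> first gives
  \<open>h\<close> times the average, integrating over \<open>x\<close> first gives
  \<open>f t\<close> times the mass of \<open>{t - h<..t}\<close>.\<close>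

lemma integral_window_average:
  assumes M: "finite_measure M" "sets M = sets borel"
    and f [measurable]: "f \<in> borel_measurable borel"
    and bnd: "\<And>t. \<bar>f t\<bar> \<le> B" and supp: "\<And>t. t \<notin> {a..b} \<Longrightarrow> f t = 0" and h: "0 < h"
  shows "integrable lborel (\<lambda>t. f t * (measure M {..t} - measure M {..t - h}))" (is ?int)
    and "(\<integral>x. window_average h f x \<partial>M) =
      (\<integral>t. f t * (measure M {..t} - measure M {..t - h}) \<partial>lborel) / h" (is ?eq)
proof -
  interpret M: finite_measure M by fact
  interpret pair_sigma_finite "lborel :: real measure" M ..
  note [measurable_cong] = M(2)
  have space: "space M = UNIV" using sets_eq_imp_space_eq[OF M(2)] by simp
  define k where "k t x = f t * (if x \<le> t \<and> t < x + h then 1 else 0)" for t x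
  have k_meas [measurable]: "case_prod k \<in> borel_measurable (lborel \<Otimes>\<^sub>M M)"
    unfolding k_def by measurable
  have k: "integrable (lborel \<Otimes>\<^sub>M M) (case_prod k)"
  \<comment> \<open>The kernel is bounded by \<open>B\<close> and vanishes off the strip over
    \<open>{a..b}\<close>, which has finite product measure because \<open>M\<close> is
    finite.\<close>
  proof (rule integrableI_bounded_set[where A = "{a..b} \<times> UNIV" and B = B])
    show "{a..b} \<times> UNIV \<in> sets (lborel \<Otimes>\<^sub>M M)"
      by (intro pair_measureI) (auto simp: M)
    have "emeasure (lborel \<Otimes>\<^sub>M M) ({a..b} \<times> UNIV) = emeasure lborel {a..b} * emeasure M UNIV"
      by (intro M.emeasure_pair_measure_Times) (auto simp: M)
    then show "emeasure (lborel \<Otimes>\<^sub>M M) ({a..b} \<times> UNIV) < \<infinity>"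
      by (simp add: emeasure_lborel_Icc_eq M.emeasure_eq_measure ennreal_mult_less_top)
    have "norm (k t x) \<le> B" for t x
      using bnd[of t] by (auto simp: k_def)
    then show "AE p in lborel \<Otimes>\<^sub>M M. p \<in> {a..b} \<times> UNIV \<longrightarrow> norm (case_prod k p) \<le> B"
      by auto
    have "case_prod k p = 0" if "p \<notin> {a..b} \<times> UNIV" for p
      using supp[of "fst p"] that by (cases p) (simp add: k_def)
    then show "AE p in lborel \<Otimes>\<^sub>M M. p \<notin> {a..b} \<times> UNIV \<longrightarrow> case_prod k p = 0"
      by blast
  qed (rule k_meas)
  have inner: "(\<integral>x. k t x \<partial>M) = f t * (measure M {..t} - measure M {..t - h})" for t
  proof -
    have "(\<integral>x. k t x \<partial>M) = (\<integral>x. f t * indicator {t - h<..t} x \<partial>M)"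
      by (intro Bochner_Integration.integral_cong) (auto simp: k_def indicator_def)
    also have "\<dots> = f t * measure M {t - h<..t}"
      by (simp add: space)
    also have "{t - h<..t} = {..t} - {..t - h}" by auto
    also have "measure M \<dots> = measure M {..t} - measure M {..t - h}"
      using h by (intro M.finite_measure_Diff) (auto simp: M)
    finally show ?thesis .
  qed
  show ?int
    using integrable_fst[OF k] by (simp add: inner)
  have "(\<integral>x. window_average h f x \<partial>M) = (\<integral>x. (\<integral>t. k t x \<partial>lborel) / h \<partial>M)"
    unfolding window_average_def
    by (intro Bochner_Integration.integral_cong refl arg_cong2[where f = "(/)"])
      (auto simp: k_def indicator_def)
  also have "\<dots> = (\<integral>t. (\<integral>x. k t x \<partial>M) \<partial>lborel) / h"
    using Fubini_integral[OF k] by simp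
  finally show ?eq by (simp add: inner)
qed

lemma signed_integral_window_average:
  assumes \<mu>: "finite_signed_measure borel \<mu>"
    and f [measurable]: "f \<in> borel_measurable borel"
    and bnd: "\<And>t. \<bar>f t\<bar> \<le> B" and supp: "\<And>t. t \<notin> {a..b} \<Longrightarrow> f t = 0" and h: "0 < h"
  shows "integrable lborel (\<lambda>t. f t * (signed_cdf \<mu> t - signed_cdf \<mu> (t - h)))"
    and "signed_integral borel \<mu> (window_average h f) =
      (\<integral>t. f t * (signed_cdf \<mu> t - signed_cdf \<mu> (t - h)) \<partial>lborel) / h"
proof -
  note P = integral_window_average[OF finite_measure_upper_variation[OF \<mu>] _ f bnd supp h, simplified]
  note N = integral_window_average[OF finite_measure_lower_variation[OF \<mu>] _ f bnd supp h, simplified]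
  have *: "f t * (signed_cdf \<mu> t - signed_cdf \<mu> (t - h)) =
      f t * (measure (upper_variation borel \<mu>) {..t} - measure (upper_variation borel \<mu>) {..t - h}) -
      f t * (measure (lower_variation borel \<mu>) {..t} - measure (lower_variation borel \<mu>) {..t - h})" for t
    by (simp add: signed_cdf_def Jordan_decomposition[OF \<mu>] algebra_simps)
  show "integrable lborel (\<lambda>t. f t * (signed_cdf \<mu> t - signed_cdf \<mu> (t - h)))"
    unfolding * by (intro Bochner_Integration.integrable_diff P N)
  show "signed_integral borel \<mu> (window_average h f) =
      (\<integral>t. f t * (signed_cdf \<mu> t - signed_cdf \<mu> (t - h)) \<partial>lborel) / h"
    unfolding * signed_integral_def
    by (subst Bochner_Integration.integral_diff) (simp_all only: P N diff_divide_distrib)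
qed

section \<open>Passage to the limit, first for window averages, then for test functions\<close>

lemma abs_signed_cdf_diff_le:
  assumes \<mu>: "finite_signed_measure borel \<mu>" and st: "s \<le> t" "{s<..t} \<subseteq> S" and S: "S \<in> sets borel"
  shows "\<bar>signed_cdf \<mu> t - signed_cdf \<mu> s\<bar> \<le> measure (total_variation borel \<mu>) S"
proof -
  have "{..t} = {..s} \<union> {s<..t}" "{..s} \<inter> {s<..t} = {}" using st(1) by auto
  then have "signed_cdf \<mu> t - signed_cdf \<mu> s = \<mu> {s<..t}"
    using finite_signed_measure_Un[OF \<mu>, of "{..s}" "{s<..t}"] by (auto simp: signed_cdf_def)
  also have "\<dots> = signed_integral borel \<mu> (indicator {s<..t})"
    by (simp add: signed_integral_indicator[OF \<mu>])
  finally have eq: "signed_cdf \<mu> t - signed_cdf \<mu> s = signed_integral borel \<mu> (indicator {s<..t})" .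
  have "\<bar>indicator {s<..t} x\<bar> \<le> (1 * indicator S x :: real)" for x
    using st(2) by (auto simp: indicator_def)
  from abs_signed_integral_le[OF \<mu> S this] show ?thesis
    by (simp add: eq)
qed

text \<open>The error is an integral of \<open>f\<close> against increments of \<open>E n\<close>.
  These are small off a set whose measure tends to 0 and bounded uniformly in \<open>n\<close> on
  that set.\<close>

lemma cdf_converges_imp_window_average_tendsto:
  assumes \<mu>s: "\<And>n. finite_signed_measure borel (\<mu>s n)" and \<mu>: "finite_signed_measure borel \<mu>"
    and bv: "locally_uniformly_bounded_variation \<mu>s"
    and conv: "converges_locally_in_lebesgue_measure (\<lambda>n x. signed_cdf (\<mu>s n) x + c n) (signed_cdf \<mu>)"
    and f [measurable]: "f \<in> borel_measurable borel" and bnd: "\<And>t. \<bar>f t\<bar> \<le> B"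
    and supp: "\<And>t. t \<notin> {-r..r} \<Longrightarrow> f t = 0" and r: "0 < r" and h: "0 < h" "h \<le> 1"
  shows "(\<lambda>n. signed_integral borel (\<mu>s n) (window_average h f)) \<longlonglongrightarrow>
    signed_integral borel \<mu> (window_average h f)"
proof -
  note [measurable] = borel_measurable_signed_cdf[OF \<mu>s] borel_measurable_signed_cdf[OF \<mu>]
  let ?S = "{-(r + 1)..r + 1}"
  obtain K where K: "0 \<le> K" "\<And>n. measure (total_variation borel (\<mu>s n)) ?S \<le> K"
    using locally_uniformly_bounded_variationE[OF \<mu>s bv, of "r + 1"] by auto
  define K' where "K' = K + measure (total_variation borel \<mu>) ?S"
  have K': "0 \<le> K'" using K(1) by (simp add: K'_def)
  have B: "0 \<le> B" using bnd[of 0] by linarith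
  \<comment> \<open>The constant \<open>c n\<close> may be included here because only increments of
    \<open>E n\<close> enter the integrals, and it cancels in them.\<close>
  define E where "E n t = signed_cdf (\<mu>s n) t + c n - signed_cdf \<mu> t" for n t
  have [measurable]: "E n \<in> borel_measurable borel" for n
    unfolding E_def by measurable
  \<comment> \<open>The bad set is taken in the enlarged interval because \<open>t - h\<close> may
    leave \<open>{-r..r}\<close>, by at most 1.\<close>
  define A where "A \<delta> n = {s \<in> ?S. \<delta> < \<bar>E n s\<bar>}" for \<delta> n
  have A [measurable]: "A \<delta> n \<in> sets borel" for \<delta> n
    unfolding A_def by measurable
  have finA: "emeasure lborel (A \<delta> n) < \<infinity>" for \<delta> n
  proof -
    have "emeasure lborel (A \<delta> n) \<le> emeasure lborel ?S"
      by (intro emeasure_mono) (auto simp: A_def)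
    also have "\<dots> < \<infinity>" by (simp add: emeasure_lborel_Icc_eq)
    finally show ?thesis .
  qed
  have limA: "(\<lambda>n. measure lborel (A \<delta> n)) \<longlonglongrightarrow> 0" if "0 < \<delta>" for \<delta>
  proof -
    have "\<forall>\<epsilon>>0. \<forall>r>0. (\<lambda>n. measure lborel {x \<in> {-r..r}.
        \<bar>signed_cdf (\<mu>s n) x + c n - signed_cdf \<mu> x\<bar> > \<epsilon>}) \<longlonglongrightarrow> 0"
      using conv by (subst (asm) converges_locally_in_lebesgue_measure_iff) measurable
    from this[rule_format, OF that, of "r + 1"] r show ?thesis
      by (simp add: A_def E_def)
  qed
  have diff: "signed_integral borel (\<mu>s n) (window_average h f) -
      signed_integral borel \<mu> (window_average h f) = (\<integral>t. f t * (E n t - E n (t - h)) \<partial>lborel) / h"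
    and int: "integrable lborel (\<lambda>t. f t * (E n t - E n (t - h)))" for n
  proof -
    note 1 = signed_integral_window_average[OF \<mu>s[of n] f bnd supp h(1)]
    note 2 = signed_integral_window_average[OF \<mu> f bnd supp h(1)]
    have *: "f t * (E n t - E n (t - h)) =
        f t * (signed_cdf (\<mu>s n) t - signed_cdf (\<mu>s n) (t - h)) -
        f t * (signed_cdf \<mu> t - signed_cdf \<mu> (t - h))" for t
      by (simp add: E_def algebra_simps)
    show "signed_integral borel (\<mu>s n) (window_average h f) -
      signed_integral borel \<mu> (window_average h f) = (\<integral>t. f t * (E n t - E n (t - h)) \<partial>lborel) / h"
      using Bochner_Integration.integral_diff[OF 1(1) 2(1)] 1(2) 2(2)
      by (simp only: * diff_divide_distrib)
    show "integrable lborel (\<lambda>t. f t * (E n t - E n (t - h)))"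
      unfolding * by (intro Bochner_Integration.integrable_diff 1 2)
  qed
  have ptw: "\<bar>f t * (E n t - E n (t - h))\<bar> \<le>
      B * (2 * \<delta> * indicator {-r..r} t + K' * (indicator (A \<delta> n) t + indicator (A \<delta> n) (t - h)))"
    if \<delta>: "0 < \<delta>" for \<delta> n t
  proof (cases "t \<in> {-r..r}")
    case False
    then show ?thesis using supp[OF False] B K' by simp
  next
    case True
    \<comment> \<open>If neither \<open>t\<close> nor \<open>t - h\<close> is bad, each error is at
      most \<open>\<delta>\<close>. Otherwise the variations of \<open>\<mu>s n\<close> and
      \<open>\<mu>\<close> bound the increment by \<open>K'\<close>, and at least one of the two
      indicators is 1.\<close>
    have "\<bar>E n t - E n (t - h)\<bar> \<le> 2 * \<delta> + K' * (indicator (A \<delta> n) t + indicator (A \<delta> n) (t - h))"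
    proof (cases "t \<in> A \<delta> n \<or> t - h \<in> A \<delta> n")
      case False
      then have "\<bar>E n t\<bar> \<le> \<delta>" "\<bar>E n (t - h)\<bar> \<le> \<delta>"
        using True h by (auto simp: A_def)
      then show ?thesis using K' False by (simp add: indicator_def)
    next
      case A: True
      have "{t - h<..t} \<subseteq> ?S" "t - h \<le> t" using True h by auto
      then have "\<bar>signed_cdf (\<mu>s n) t - signed_cdf (\<mu>s n) (t - h)\<bar> \<le> K"
        "\<bar>signed_cdf \<mu> t - signed_cdf \<mu> (t - h)\<bar> \<le> K' - K"
        using abs_signed_cdf_diff_le[OF \<mu>s[of n], of "t - h" t ?S] K(2)[of n]
          abs_signed_cdf_diff_le[OF \<mu>, of "t - h" t ?S] by (auto simp: K'_def)
      then have "\<bar>E n t - E n (t - h)\<bar> \<le> K'"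
        by (simp add: E_def)
      then show ?thesis using A \<delta> K' by (auto simp: indicator_def)
    qed
    then show ?thesis
      using True bnd[of t] B by (simp add: abs_mult mult_mono)
  qed
  \<comment> \<open>By translation invariance, the bad set and its shift by \<open>h\<close>
    contribute the same measure.\<close>
  have shift: "(\<integral>t. indicator (A \<delta> n) (t - h) \<partial>lborel :: real) = measure lborel (A \<delta> n)"
    and int_shift: "integrable lborel (\<lambda>t. indicator (A \<delta> n) (t - h) :: real)"
    and int_ind: "integrable lborel (indicator (A \<delta> n) :: real \<Rightarrow> real)" for \<delta> n
  proof -
    show ind: "integrable lborel (indicator (A \<delta> n) :: real \<Rightarrow> real)"
      using finA by simp
    show "integrable lborel (\<lambda>t. indicator (A \<delta> n) (t - h) :: real)"
      using lborel_integrable_real_affine[OF ind, of 1 "-h"] by simp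
    show "(\<integral>t. indicator (A \<delta> n) (t - h) \<partial>lborel :: real) = measure lborel (A \<delta> n)"
      using lborel_integral_real_affine[of 1 "indicator (A \<delta> n) :: real \<Rightarrow> real" "-h"] by simp
  qed
  have est: "\<bar>\<integral>t. f t * (E n t - E n (t - h)) \<partial>lborel\<bar> \<le>
      B * (4 * r * \<delta> + 2 * K' * measure lborel (A \<delta> n))" if \<delta>: "0 < \<delta>" for n \<delta>
  proof -
    have "\<bar>\<integral>t. f t * (E n t - E n (t - h)) \<partial>lborel\<bar> \<le> (\<integral>t. \<bar>f t * (E n t - E n (t - h))\<bar> \<partial>lborel)"
      by (rule integral_abs_bound)
    also have "\<dots> \<le> (\<integral>t. B * (2 * \<delta> * indicator {-r..r} t +
        K' * (indicator (A \<delta> n) t + indicator (A \<delta> n) (t - h))) \<partial>lborel)"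
      by (intro integral_mono integrable_abs int ptw \<delta> integrable_mult_right integrable_real_indicator
          Bochner_Integration.integrable_add int_shift int_ind) (auto simp: emeasure_lborel_Icc_eq)
    also have "\<dots> = B * (2 * \<delta> * (2 * r) + K' * (measure lborel (A \<delta> n) + measure lborel (A \<delta> n)))"
      using r int_shift int_ind
      by (simp add: shift Bochner_Integration.integral_add emeasure_lborel_Icc_eq)
    finally show ?thesis by (simp add: algebra_simps)
  qed
  have "(\<lambda>n. \<integral>t. f t * (E n t - E n (t - h)) \<partial>lborel) \<longlonglongrightarrow> 0"
  proof (rule LIMSEQ_I)
    fix e :: real assume e: "0 < e"
    \<comment> \<open>This choice makes the first term of \<open>est\<close> at most
      \<open>e / 2\<close>; \<open>B + 1\<close> replaces \<open>B\<close> to avoid division by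
      0.\<close>
    define \<delta> where "\<delta> = e / (8 * r * (B + 1))"
    have \<delta>: "0 < \<delta>" using e r B by (simp add: \<delta>_def)
    have "B * (4 * r * \<delta>) \<le> (B + 1) * (4 * r * \<delta>)"
      using r \<delta> by (intro mult_right_mono) auto
    also have "\<dots> = e / 2"
    proof -
      have "B + 1 \<noteq> 0" using B by simp
      then show ?thesis using r by (simp add: \<delta>_def divide_simps)
    qed
    finally have small: "B * (4 * r * \<delta>) \<le> e / 2" .
    have "(\<lambda>n. B * (2 * K' * measure lborel (A \<delta> n))) \<longlonglongrightarrow> B * (2 * K' * 0)"
      by (intro tendsto_intros limA \<delta>)
    then obtain N where N: "\<And>n. N \<le> n \<Longrightarrow> \<bar>B * (2 * K' * measure lborel (A \<delta> n))\<bar> < e / 2"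
      using LIMSEQ_D[OF _ half_gt_zero[OF e], of "\<lambda>n. B * (2 * K' * measure lborel (A \<delta> n))" 0] by auto
    have "norm ((\<integral>t. f t * (E n t - E n (t - h)) \<partial>lborel) - 0) < e" if "N \<le> n" for n
      using est[OF \<delta>, of n] N[OF that] small by (simp add: distrib_left)
    then show "\<exists>N. \<forall>n\<ge>N. norm ((\<integral>t. f t * (E n t - E n (t - h)) \<partial>lborel) - 0) < e" by blast
  qed
  then have "(\<lambda>n. (\<integral>t. f t * (E n t - E n (t - h)) \<partial>lborel) / h) \<longlonglongrightarrow> 0"
    using tendsto_divide_zero by blast
  then show ?thesis
    unfolding diff[symmetric] by (rule LIM_zero_cancel)
qed

text \<open>A three-term estimate: replacing \<open>f\<close> by its window average costs at most
  \<open>\<eta> * K\<close> for every \<open>\<mu>s n\<close> and \<open>\<eta> * K'\<close> for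
  \<open>\<mu>\<close>, and for fixed \<open>h\<close> the integrals of the averages
  converge.\<close>

lemma cdf_converges_imp_vaguely_converges:
  assumes \<mu>s: "\<And>n. finite_signed_measure borel (\<mu>s n)" and \<mu>: "finite_signed_measure borel \<mu>"
    and bv: "locally_uniformly_bounded_variation \<mu>s"
    and conv: "converges_locally_in_lebesgue_measure (\<lambda>n x. signed_cdf (\<mu>s n) x + c n) (signed_cdf \<mu>)"
  shows "vaguely_converges \<mu>s \<mu>"
  unfolding vaguely_converges_def
proof (intro allI impI)
  fix f :: "real \<Rightarrow> real"
  assume f: "continuous_on UNIV f" and "compact (closure {x. f x \<noteq> 0})"
  then have "bounded {x. f x \<noteq> 0}" by simp
  then obtain r where r: "0 < r" "\<And>x. f x \<noteq> 0 \<Longrightarrow> \<bar>x\<bar> \<le> r"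
    by (auto simp: bounded_pos)
  then have supp: "f x = 0" if "x \<notin> {-r..r}" for x
    using that by (cases "f x = 0") force+
  have [measurable]: "f \<in> borel_measurable borel"
    using f by (rule borel_measurable_continuous_onI)
  have "compact (f ` {-r..r})"
    using f by (intro compact_continuous_image) (auto intro: continuous_on_subset)
  then obtain B where B0: "0 < B" "\<And>x. x \<in> {-r..r} \<Longrightarrow> \<bar>f x\<bar> \<le> B"
    using compact_imp_bounded by (force simp: bounded_pos)
  then have B: "\<bar>f x\<bar> \<le> B" for x
    using supp[of x] by (cases "x \<in> {-r..r}") auto
  let ?S = "{-(r + 1)..r + 1}"
  obtain K where K: "0 \<le> K" "\<And>n. measure (total_variation borel (\<mu>s n)) ?S \<le> K"
    using locally_uniformly_bounded_variationE[OF \<mu>s bv, of "r + 1"] by auto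
  define K' where "K' = measure (total_variation borel \<mu>) ?S"
  have K': "0 \<le> K'" by (simp add: K'_def)
  show "(\<lambda>n. signed_integral borel (\<mu>s n) f) \<longlonglongrightarrow> signed_integral borel \<mu> f"
  proof (rule LIMSEQ_I)
    fix e :: real assume e: "0 < e"
    define D where "D = K + K' + 1"
    have D: "0 < D" "K + K' \<le> D" using K(1) K' by (auto simp: D_def)
    \<comment> \<open>Both replacement errors together are then at most \<open>e / 2\<close>, which
      leaves \<open>e / 2\<close> for the averages.\<close>
    define \<eta> where "\<eta> = e / (2 * D)"
    have \<eta>: "0 < \<eta>" using e D by (simp add: \<eta>_def)
    have "\<eta> * (K + K') \<le> \<eta> * D"
      using \<eta> D by (intro mult_left_mono) auto
    also have "\<dots> = e / 2"
      using D by (simp add: \<eta>_def)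
    finally have small: "\<eta> * K + \<eta> * K' \<le> e / 2" by (simp add: distrib_left)
    \<comment> \<open>The interval has to contain all windows of width at most 1 that start in
      \<open>{-(r + 1)..r + 1}\<close>.\<close>
    have "uniformly_continuous_on {-(r + 2)..r + 2} f"
      using f by (intro compact_uniformly_continuous) (auto intro: continuous_on_subset)
    then obtain d where d: "0 < d" "\<And>x t. x \<in> {-(r + 2)..r + 2} \<Longrightarrow> t \<in> {-(r + 2)..r + 2} \<Longrightarrow>
        \<bar>t - x\<bar> < d \<Longrightarrow> \<bar>f t - f x\<bar> < \<eta>"
      using \<eta> unfolding uniformly_continuous_on_def dist_real_def by blast
    define h where "h = min 1 d"
    have h: "0 < h" "h \<le> 1" "h \<le> d" using d(1) by (auto simp: h_def)
    have close: "\<bar>window_average h f x - f x\<bar> \<le> \<eta> * indicator ?S x" for x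
    proof (cases "x \<in> ?S")
      case True
      have "\<bar>window_average h f x - f x\<bar> \<le> \<eta>"
      proof (rule window_average_close[OF _ h(1)])
        show "\<bar>f t - f x\<bar> \<le> \<eta>" if "x \<le> t" "t < x + h" for t
          using d(2)[of x t] True that h by auto
      qed measurable
      with True show ?thesis by simp
    next
      case False
      then have "f x = 0" by (intro supp) auto
      \<comment> \<open>Outside \<open>{-(r + 1)..r + 1}\<close> a window of width at most 1 misses
        \<open>{-r..r}\<close>, hence the support of \<open>f\<close>.\<close>
      moreover have "window_average h f x = 0"
        using False h by (intro window_average_eq_0 supp) auto
      ultimately show ?thesis using \<eta> by simp
    qed
    have wbnd: "\<bar>window_average h f x\<bar> \<le> B + \<eta>" for x
    proof -
      have "\<eta> * indicator ?S x \<le> \<eta>" using \<eta> by (simp add: indicator_def)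
      then show ?thesis using close[of x] B[of x] by linarith
    qed
    have approx: "\<bar>signed_integral borel \<nu> (window_average h f) - signed_integral borel \<nu> f\<bar> \<le>
        \<eta> * measure (total_variation borel \<nu>) ?S" if \<nu>: "finite_signed_measure borel \<nu>" for \<nu>
    proof -
      have "signed_integral borel \<nu> (\<lambda>x. window_average h f x - f x) =
          signed_integral borel \<nu> (window_average h f) - signed_integral borel \<nu> f"
        by (rule signed_integral_diff[OF \<nu> _ wbnd _ B]) measurable
      then show ?thesis
        using abs_signed_integral_le[OF \<nu> _ close] by simp
    qed
    have "(\<lambda>n. signed_integral borel (\<mu>s n) (window_average h f)) \<longlonglongrightarrow>
        signed_integral borel \<mu> (window_average h f)"
      using B supp r(1) h
      by (intro cdf_converges_imp_window_average_tendsto[OF \<mu>s \<mu> bv conv]) auto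
    from LIMSEQ_D[OF this half_gt_zero[OF e]] obtain N where
      N: "\<And>n. N \<le> n \<Longrightarrow> \<bar>signed_integral borel (\<mu>s n) (window_average h f) -
        signed_integral borel \<mu> (window_average h f)\<bar> < e / 2"
      by auto
    have "norm (signed_integral borel (\<mu>s n) f - signed_integral borel \<mu> f) < e" if "N \<le> n" for n
    proof -
      have "\<eta> * measure (total_variation borel (\<mu>s n)) ?S \<le> \<eta> * K"
        using \<eta> K(2) by (intro mult_left_mono) auto
      then show ?thesis
        using approx[OF \<mu>s[of n]] approx[OF \<mu>, folded K'_def] N[OF that] small
        unfolding real_norm_def by linarith
    qed
    then show "\<exists>N. \<forall>n\<ge>N. norm (signed_integral borel (\<mu>s n) f - signed_integral borel \<mu> f) < e"
      by blast
  qed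
qed

theorem corollary3p14:
  fixes \<mu>s :: "nat \<Rightarrow> real set \<Rightarrow> real" and \<mu> :: "real set \<Rightarrow> real"
  assumes "\<And>n. finite_signed_measure borel (\<mu>s n)"
    and "finite_signed_measure borel \<mu>"
  shows "vaguely_converges \<mu>s \<mu> \<longleftrightarrow>
    locally_uniformly_bounded_variation \<mu>s \<and>
    (\<exists>c :: nat \<Rightarrow> real.
      converges_locally_in_lebesgue_measure (\<lambda>n x. signed_cdf (\<mu>s n) x + c n) (signed_cdf \<mu>))"
proof (intro iffI conjI)
  assume "vaguely_converges \<mu>s \<mu>"
  then show "locally_uniformly_bounded_variation \<mu>s"
    and "\<exists>c. converges_locally_in_lebesgue_measure (\<lambda>n x. signed_cdf (\<mu>s n) x + c n) (signed_cdf \<mu>)"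
    using vaguely_converges_imp_locally_bounded[of \<mu>s \<mu>] vaguely_converges_imp_cdf_converges[of \<mu>s \<mu>]
      assms by blast+
next
  assume "locally_uniformly_bounded_variation \<mu>s \<and>
    (\<exists>c. converges_locally_in_lebesgue_measure (\<lambda>n x. signed_cdf (\<mu>s n) x + c n) (signed_cdf \<mu>))"
  then show "vaguely_converges \<mu>s \<mu>"
    using cdf_converges_imp_vaguely_converges[of \<mu>s \<mu>] assms by blast
qed

end
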